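(* Let $\mathcal G=(V,E,\mathfrak c)$ be a countably infinite, connected, locally finite graph with conductances. Let $X:[0,\infty)\to V\cup\{\infty\}$ be the continuous time random walk on $\mathcal G$ reflected off of infinity. Almost surely, for each $t\in[0,\infty)$ such that $X_t=\infty$, there is a unique end $\omega_t$ of $\mathcal G$ such that the following is true. Let $\{V_n\}_{n\ge1}$ be any increasing family of finite, non-empty subsets of $V$ whose union is all of $V$, and let $\{C_n(\omega_t)\}_{n\ge1}$ be the associated sequence of connected components of $V\setminus V_n$ determined by the end $\omega_t$. Then for each $n\ge1$, there exists $\varepsilon>0$ such that $$X_s\in C_n(\omega_t)\cup\{\infty\},\quad\forall s\in(t-\varepsilon,t+\varepsilon).$$
   Context: $\mathcal G=(V,E,\mathfrak c)$ is a graph with vertex set $V$, set $E$ of unoriented edges (unordered pairs of distinct vertices) and conductance function $\mathfrak c:E\to(0,\infty)$; locally finite means every vertex has finite degree. Write $x\sim y$ if $x,y$ are joined by an edge, $\mathfrak c(x,y)=\mathfrak c(y,x)$ for its conductance, and $\pi(x)=\sum_{y\sim x}\mathfrak c(x,y)$. Energy-minimizing functions. $\operatorname{Energy}(f)=\sum_{\{x,y\}\in E}\mathfrak c(x,y)|f(y)-f(x)|^2$. For each non-empty finite $\mathcal A\subset V$ and $\phi:\mathcal A\to\mathbb R$ there is a unique $h^\phi:V\to\mathbb R$ with $h^\phi|_{\mathcal A}=\phi$ of minimal energy among all functions $f:V\to\mathbb R$ with $f|_{\mathcal A}=\phi$. Random walk reflected off of infinity. There is a function $\mathfrak w_*:V\to(0,\infty)$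 such that for every $\mathfrak w:V\to(0,\infty)$ with $\mathfrak w\ge\mathfrak w_*$ pointwise there is a unique (in law) family of processes $X:[0,\infty)\to V\cup\{\infty\}$, started from $X_0=z$ for each $z\in V$ (law $\mathbb P_z$), such that: (i) for each $t\ge0$, a.s. $X_t\in V$ and $X$ is constant on a neighbourhood of $t$ in $[0,\infty)$; (ii) a.s., for every $t\ge 0$ with $X_t\in V$ there is $\varepsilon>0$ with $X_s=X_t$ for all $s\in[t,t+\varepsilon]$; (iii) with $\tau=\min\{t>0:X_t\ne z\}$, $\tau$ and $X_\tau$ are independent, $\tau$ is exponential with rate $\mathfrak w(z)$, and $\mathbb P_z[X_\tau=x]=\mathfrak c(z,x)/\pi(z)$ for $x\sim z$; (iv) for $t\ge0$ and $x\in V$, on $\{X_t=x\}$ the conditional law of $\{X_{s+t}\}_{s\ge0}$ given $\{X_s\}_{s\le t}$ is the law of $X$ under $\mathbb P_x$; (v) a.s. there are arbitrarily large $t$ with $X_t=z$; (vi) for every non-empty finite $\mathcal A\subset V$, $\phi:\mathcal A\to\mathbb R$ and $z\in V$, with $\tau=\min\{t\ge0:X_t\in\mathcal A\}$, $h^\phi(z)=\mathbb E_z[\phi(X_\tau)]$. Fix such $\mathfrak w_*$ and $\mathfrak w\ge\mathfrak w_*$; $X$ denotes this process, started from an arbitrary fixed vertex. Ends. Let $\mathcal P$ be the set of simple one-sided infinite paths $P:\mathbb N_0\to V$ in $\mathcal G$. Define $P\sim Q$ if for each finite $A\subset V$ there is exactly one connected component of $V\setminus A$ (for the induced subgraph)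 containing both infinitely many vertices of $P$ and infinitely many vertices of $Q$. An end is an equivalence class $\omega$ of this relation. Given an increasing family $\{V_n\}$ of finite subsets of $V$ with union $V$, $C_n(\omega)$ is the unique connected component of $V\setminus V_n$ which contains infinitely many vertices of $P$, for any $P\in\omega$. *)

theory Defs
  imports "HOL-Probability.Probability"
begin

section \<open>Graphs with conductances\<close>

text \<open>
  The vertex set is the whole type \<open>'v\<close>.  Edges are unordered pairs of distinct vertices,
  and \<open>c {x, y}\<close> is the conductance of the edge \<open>{x, y}\<close>.
\<close>

definition conductance_graph :: "'v set set \<Rightarrow> ('v set \<Rightarrow> real) \<Rightarrow> bool" where
  "conductance_graph E c \<longleftrightarrow>
     (\<forall>e\<in>E. \<exists>x y. x \<noteq> y \<and> e = {x, y}) \<and> (\<forall>e\<in>E. 0 < c e)"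

definition nbrs :: "'v set set \<Rightarrow> 'v \<Rightarrow> 'v set" where
  "nbrs E x = {y. {x, y} \<in> E}"

definition locally_finite_graph :: "'v set set \<Rightarrow> bool" where
  "locally_finite_graph E \<longleftrightarrow> (\<forall>x. finite (nbrs E x))"

definition adj_off :: "'v set set \<Rightarrow> 'v set \<Rightarrow> ('v \<times> 'v) set" where
  "adj_off E A = {(x, y). x \<notin> A \<and> y \<notin> A \<and> {x, y} \<in> E}"

definition components_off :: "'v set set \<Rightarrow> 'v set \<Rightarrow> 'v set set" where
  "components_off E A = {{y. (x, y) \<in> (adj_off E A)\<^sup>*} | x. x \<notin> A}"

definition connected_graph :: "'v set set \<Rightarrow> bool" where
  "connected_graph E \<longleftrightarrow> (\<forall>x y. (x, y) \<in> (adj_off E {})\<^sup>*)"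

definition vertex_weight :: "'v set set \<Rightarrow> ('v set \<Rightarrow> real) \<Rightarrow> 'v \<Rightarrow> real" where
  "vertex_weight E c x = (\<Sum>y\<in>nbrs E x. c {x, y})"

section \<open>Energy-minimizing functions\<close>

text \<open>For an edge \<open>e = {x, y}\<close> the quantity \<open>Max (f ` e) - Min (f ` e)\<close> is \<open>\<bar>f y - f x\<bar>\<close>.\<close>

definition energy :: "'v set set \<Rightarrow> ('v set \<Rightarrow> real) \<Rightarrow> ('v \<Rightarrow> real) \<Rightarrow> ennreal" where
  "energy E c f = (\<Sum>\<^sub>\<infinity>e\<in>E. ennreal (c e * (Max (f ` e) - Min (f ` e))\<^sup>2))"

text \<open>Only the values of \<open>\<phi>\<close> on \<open>A\<close> matter.\<close>

definition energy_minimizer ::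
  "'v set set \<Rightarrow> ('v set \<Rightarrow> real) \<Rightarrow> 'v set \<Rightarrow> ('v \<Rightarrow> real) \<Rightarrow> ('v \<Rightarrow> real) \<Rightarrow> bool" where
  "energy_minimizer E c A \<phi> h \<longleftrightarrow>
     (\<forall>a\<in>A. h a = \<phi> a) \<and>
     (\<forall>f. (\<forall>a\<in>A. f a = \<phi> a) \<longrightarrow> energy E c h \<le> energy E c f)"

definition energy_min_extension ::
  "'v set set \<Rightarrow> ('v set \<Rightarrow> real) \<Rightarrow> 'v set \<Rightarrow> ('v \<Rightarrow> real) \<Rightarrow> 'v \<Rightarrow> real" where
  "energy_min_extension E c A \<phi> = (THE h. energy_minimizer E c A \<phi> h)"

section \<open>Random walk reflected off of infinity\<close>

text \<open>
  The state space is \<open>'v option\<close>, with \<open>None\<close> in the role of the point \<open>\<infinity>\<close>.  A trajectory is a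
  function on \<open>real\<close> of which only the values at times \<open>t \<ge> 0\<close> are meaningful, and \<open>path\<close> cuts
  it down to \<open>[0, \<infinity>)\<close>.  A family of processes consists of a probability space \<open>M z\<close> and a
  process \<open>X z\<close> on it for every starting vertex \<open>z\<close>.

  Random times such as a first exit time are in general measurable only up to null sets (they
  are defined through uncountably many times), so random variables and events formed from
  them are taken with respect to the completed measure.
\<close>

definition path :: "(real \<Rightarrow> 'w \<Rightarrow> 'a) \<Rightarrow> 'w \<Rightarrow> (real \<Rightarrow> 'a)" where
  "path Y \<omega> = (\<lambda>t\<in>{0..}. Y t \<omega>)"

definition past :: "'w measure \<Rightarrow> (real \<Rightarrow> 'w \<Rightarrow> 'a) \<Rightarrow> real \<Rightarrow> 'w measure" where
  "past M Y t =
     vimage_algebra (space M) (\<lambda>\<omega>. \<lambda>s\<in>{0..t}. Y s \<omega>) (\<Pi>\<^sub>M s\<in>{0..t}. count_space UNIV)"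

text \<open>Here \<open>Inf T\<close> is the minimum of \<open>T\<close> exactly when \<open>Inf T \<in> T\<close>, as all times are \<open>\<ge> 0\<close>.\<close>

definition exit_times :: "(real \<Rightarrow> 'w \<Rightarrow> 'v option) \<Rightarrow> 'v \<Rightarrow> 'w \<Rightarrow> real set" where
  "exit_times Y z \<omega> = {t. 0 < t \<and> Y t \<omega> \<noteq> Some z}"

definition hit_times :: "(real \<Rightarrow> 'w \<Rightarrow> 'v option) \<Rightarrow> 'v set \<Rightarrow> 'w \<Rightarrow> real set" where
  "hit_times Y A \<omega> = {t. 0 \<le> t \<and> Y t \<omega> \<in> Some ` A}"

definition first_jump_law ::
  "'v set set \<Rightarrow> ('v set \<Rightarrow> real) \<Rightarrow> ('v \<Rightarrow> real) \<Rightarrow> 'v \<Rightarrow> 'w measure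
     \<Rightarrow> (real \<Rightarrow> 'w \<Rightarrow> 'v option) \<Rightarrow> bool" where
  "first_jump_law E c w z M Y \<longleftrightarrow>
    (let \<tau> = (\<lambda>\<omega>. Inf (exit_times Y z \<omega>));
         J = (\<lambda>\<omega>. Y (\<tau> \<omega>) \<omega>)
     in (AE \<omega> in M. \<tau> \<omega> \<in> exit_times Y z \<omega>) \<and>
        J \<in> measurable (completion M) (count_space UNIV) \<and>
        prob_space.indep_set (completion M)
          (sets (vimage_algebra (space M) \<tau> borel))
          (sets (vimage_algebra (space M) J (count_space UNIV))) \<and>
        distributed (completion M) lborel \<tau> (exponential_density (w z)) \<and>
        (\<forall>x\<in>nbrs E z. measure (completion M) {\<omega>\<in>space M. J \<omega> = Some x}
                        = c {z, x} / vertex_weight E c z))"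

text \<open>
  Path regularity (local constancy, attainment of hitting times) is not an
  event of the product sigma-algebra on paths, so agreement of finite-dimensional distributions
  alone would not transfer it to the shifted process: redefining \<open>X\<close> to be \<open>\<infinity>\<close> at the instant
  at which it arrives at a given vertex for the second time does not change any
  finite-dimensional distribution.  The law of \<open>X x\<close> is therefore understood as the image of
  the completed measure under the path map, a measure on all those sets \<open>B\<close> of paths for which
  \<open>X \<in> B\<close> is an event.
\<close>

definition markov_family ::
  "('v \<Rightarrow> 'w measure) \<Rightarrow> ('v \<Rightarrow> real \<Rightarrow> 'w \<Rightarrow> 'v option) \<Rightarrow> bool" where
  "markov_family M X \<longleftrightarrow>
    (\<forall>z t x B. 0 \<le> t \<longrightarrow>
       {\<omega>\<in>space (M x). path (X x) \<omega> \<in> B} \<in> sets (completion (M x)) \<longrightarrow>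
       (let S = {\<omega>\<in>space (M z). X z t \<omega> = Some x \<and> path (\<lambda>s. X z (s + t)) \<omega> \<in> B}
        in S \<in> sets (completion (M z)) \<and>
           (AE \<omega> in M z. X z t \<omega> = Some x \<longrightarrow>
              real_cond_exp (completion (M z)) (past (M z) (X z) t) (indicator S) \<omega>
                = measure (completion (M x)) {\<omega>\<in>space (M x). path (X x) \<omega> \<in> B})))"

definition reflected_walk ::
  "'v set set \<Rightarrow> ('v set \<Rightarrow> real) \<Rightarrow> ('v \<Rightarrow> real) \<Rightarrow> ('v \<Rightarrow> 'w measure)
     \<Rightarrow> ('v \<Rightarrow> real \<Rightarrow> 'w \<Rightarrow> 'v option) \<Rightarrow> bool" where
  "reflected_walk E c w M X \<longleftrightarrow>
    (\<forall>z. prob_space (M z)) \<and>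
    (\<forall>z. \<forall>t\<ge>0. X z t \<in> measurable (M z) (count_space UNIV)) \<and>
    (\<forall>z. AE \<omega> in M z. X z 0 \<omega> = Some z) \<and>
    (\<forall>z. \<forall>t\<ge>0. AE \<omega> in M z. X z t \<omega> \<noteq> None \<and>
        (\<exists>\<epsilon>>0. \<forall>s\<ge>0. \<bar>s - t\<bar> < \<epsilon> \<longrightarrow> X z s \<omega> = X z t \<omega>)) \<and>
    (\<forall>z. AE \<omega> in M z. \<forall>t\<ge>0. X z t \<omega> \<noteq> None \<longrightarrow>
        (\<exists>\<epsilon>>0. \<forall>s\<in>{t..t+\<epsilon>}. X z s \<omega> = X z t \<omega>)) \<and>
    (\<forall>z. first_jump_law E c w z (M z) (X z)) \<and>
    markov_family M X \<and>
    (\<forall>z. AE \<omega> in M z. \<forall>T. \<exists>t\<ge>0. T \<le> t \<and> X z t \<omega> = Some z) \<and>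
    \<comment> \<open>\<open>the\<close> is harmless because the hitting time is almost surely attained\<close>
    (\<forall>A. finite A \<and> A \<noteq> {} \<longrightarrow> (\<forall>z.
       let \<tau> = (\<lambda>\<omega>. Inf (hit_times (X z) A \<omega>))
       in (AE \<omega> in M z. \<tau> \<omega> \<in> hit_times (X z) A \<omega>) \<and>
          (\<lambda>\<omega>. X z (\<tau> \<omega>) \<omega>) \<in> measurable (completion (M z)) (count_space UNIV) \<and>
          (\<forall>\<phi>. energy_min_extension E c A \<phi> z
                  = (LINT \<omega>|completion (M z). \<phi> (the (X z (\<tau> \<omega>) \<omega>))))))"

text \<open>
  A function \<open>w\<^sub>*\<close> beyond which the reflected walk exists and is unique in law.  As usual for
  processes, equality in law means equality of the laws on the product sigma-algebra
  (equivalently, of the finite-dimensional distributions).  Existence is demanded on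
  the type of trajectories, which imposes no restriction on the possible laws.
\<close>

definition reflection_threshold ::
  "'v set set \<Rightarrow> ('v set \<Rightarrow> real) \<Rightarrow> ('v \<Rightarrow> real) \<Rightarrow> bool" where
  "reflection_threshold E c w\<^sub>0 \<longleftrightarrow>
    (\<forall>x. 0 < w\<^sub>0 x) \<and>
    (\<forall>w. (\<forall>x. w\<^sub>0 x \<le> w x) \<longrightarrow>
      (\<exists>(M :: 'v \<Rightarrow> (real \<Rightarrow> 'v option) measure) X. reflected_walk E c w M X) \<and>
      (\<forall>(M :: 'v \<Rightarrow> (real \<Rightarrow> 'v option) measure) X
          (M' :: 'v \<Rightarrow> (real \<Rightarrow> 'v option) measure) X'.
         reflected_walk E c w M X \<and> reflected_walk E c w M' X' \<longrightarrow>
         (\<forall>z. distr (M z) (\<Pi>\<^sub>M t\<in>{0..}. count_space UNIV) (path (X z))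
            = distr (M' z) (\<Pi>\<^sub>M t\<in>{0..}. count_space UNIV) (path (X' z)))))"

section \<open>Ends\<close>

definition rays :: "'v set set \<Rightarrow> (nat \<Rightarrow> 'v) set" where
  "rays E = {P. inj P \<and> (\<forall>n. {P n, P (Suc n)} \<in> E)}"

definition ray_rel :: "'v set set \<Rightarrow> ((nat \<Rightarrow> 'v) \<times> (nat \<Rightarrow> 'v)) set" where
  "ray_rel E = {(P, Q). P \<in> rays E \<and> Q \<in> rays E \<and>
     (\<forall>A. finite A \<longrightarrow>
        (\<exists>!C. C \<in> components_off E A \<and> infinite (C \<inter> range P) \<and> infinite (C \<inter> range Q)))}"

definition ends :: "'v set set \<Rightarrow> (nat \<Rightarrow> 'v) set set" where
  "ends E = rays E // ray_rel E"

definition end_component :: "'v set set \<Rightarrow> 'v set \<Rightarrow> (nat \<Rightarrow> 'v) set \<Rightarrow> 'v set" where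
  "end_component E A \<xi> =
     (THE C. C \<in> components_off E A \<and> (\<forall>P\<in>\<xi>. infinite (C \<inter> range P)))"

text \<open>Increasing families are indexed by \<open>n \<ge> 1\<close>; the value at \<open>0\<close> is irrelevant.\<close>

definition finite_exhaustion :: "(nat \<Rightarrow> 'v set) \<Rightarrow> bool" where
  "finite_exhaustion W \<longleftrightarrow>
     (\<forall>n\<ge>1. finite (W n) \<and> W n \<noteq> {} \<and> W n \<subseteq> W (Suc n)) \<and> (\<Union>n\<in>{1..}. W n) = UNIV"

end

theory Submission
  imports Defs
begin

text \<open>
  Let \<open>X\<^sub>t = \<infinity>\<close> and let \<open>A\<close> be finite.  A vertex \<open>x\<close> is left only finitely often in bounded time,
  since the expected number of dyadic intervals in which an exit from \<open>x\<close> occurs is bounded.  As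
  hitting times after rational times are attained and jumps from vertices lead to vertices, \<open>X\<close>
  avoids \<open>A\<close> near \<open>t\<close>.  If \<open>x\<close> and \<open>y\<close> lie in different components of \<open>V - A\<close>, the energy minimizer
  that is \<open>0\<close> on \<open>A\<close> and \<open>1\<close> at \<open>y\<close> vanishes at \<open>x\<close>, hence the walk from \<open>x\<close> hits \<open>A\<close> before \<open>y\<close>;
  applied at rational times this confines \<open>X\<close> near \<open>t\<close> to one component of \<open>V - A\<close>.  These
  components decrease in \<open>A\<close>, and such a family of components determines a unique end.
\<close>

section \<open>Energy minimizers\<close>

text \<open>The times at which the state is \<open>None\<close> are random and possibly uncountably
  many, whereas the Markov property restarts the walk at a single deterministic time. Probabilistic
  facts are therefore phrased as properties of single trajectories and transferred to all rational
  restart times by countability; the behaviour near \<open>t\<close> is then deduced path by path.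
  Since the walk stays at a vertex for some time after each visit, every visit reaches a rational
  time. Once exits from \<open>x\<close> are finite in number, visits to \<open>x\<close> could
  touch \<open>t\<close> in two ways only. A stay ending exactly at \<open>t\<close> would be an
  exit to infinity, which jumps to vertices exclude. A stay filling an interval just after
  \<open>t\<close> would make \<open>t\<close> an unattained hitting time of \<open>x\<close>, seen
  from a rational time shortly before \<open>t\<close>. Dyadic grids fit the Markov property: an
  exit within one cell after a grid time has probability at most \<open>w x\<close> times the cell
  length, and the number of cells cancels that length. Existence and uniqueness of minimizers are
  both required because \<open>energy_min_extension\<close> is a definite description.\<close>

lemma conductance_graph_edgeD:
  assumes "conductance_graph E c" "{x, y} \<in> E"
  shows "x \<noteq> y" "0 < c {x, y}"
  using assms unfolding conductance_graph_def by (fastforce, auto)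

lemma conductance_graph_edgeE:
  assumes "conductance_graph E c" "e \<in> E"
  obtains a b where "e = {a, b}"
  using assms unfolding conductance_graph_def by meson

section \<open>Edgewise energies and the parallelogram identity\<close>

definition edge_energy :: "('v set \<Rightarrow> real) \<Rightarrow> ('v \<Rightarrow> real) \<Rightarrow> 'v set \<Rightarrow> real" where
  "edge_energy c f e = c e * (Max (f ` e) - Min (f ` e))\<^sup>2"

lemma edge_energy_pair: "edge_energy c f {a, b} = c {a, b} * (f a - f b)\<^sup>2"
  by (auto simp: edge_energy_def max_def min_def power2_commute)

lemma edge_energy_nonneg: "conductance_graph E c \<Longrightarrow> e \<in> E \<Longrightarrow> 0 \<le> edge_energy c f e"
  by (auto simp: edge_energy_def conductance_graph_def less_imp_le)

lemma energy_alt: "energy E c f = (\<Sum>\<^sub>\<infinity>e\<in>E. ennreal (edge_energy c f e))"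
  by (simp add: energy_def edge_energy_def)

lemma sum_edge_energy_le_energy:
  assumes "conductance_graph E c" "finite F" "F \<subseteq> E"
  shows "ennreal (\<Sum>e\<in>F. edge_energy c f e) \<le> energy E c f"
proof -
  have "ennreal (\<Sum>e\<in>F. edge_energy c f e) = (\<Sum>e\<in>F. ennreal (edge_energy c f e))"
    using assms edge_energy_nonneg by (subst sum_ennreal) (blast, simp)
  also have "\<dots> \<le> energy E c f"
    unfolding energy_alt using assms by (subst nonneg_infsum_complete) (auto intro: SUP_upper)
  finally show ?thesis .
qed

lemma energy_leI:
  assumes "conductance_graph E c"
    and "\<And>F. finite F \<Longrightarrow> F \<subseteq> E \<Longrightarrow> ennreal (\<Sum>e\<in>F. edge_energy c f e) \<le> K"
  shows "energy E c f \<le> K"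
  unfolding energy_alt
proof (rule infsum_le_finite_sums)
  fix F assume F: "finite F" "F \<subseteq> E"
  then have "(\<Sum>e\<in>F. ennreal (edge_energy c f e)) = ennreal (\<Sum>e\<in>F. edge_energy c f e)"
    using assms(1) edge_energy_nonneg by (subst sum_ennreal) (blast, simp)
  then show "(\<Sum>e\<in>F. ennreal (edge_energy c f e)) \<le> K" using assms(2) F by metis
qed (simp add: nonneg_summable_on_complete)

lemma energy_mono:
  assumes "\<And>e. e \<in> E \<Longrightarrow> edge_energy c f e \<le> edge_energy c g e"
  shows "energy E c f \<le> energy E c g"
  unfolding energy_alt using assms by (intro infsum_mono) (auto intro: ennreal_leI nonneg_summable_on_complete)

text \<open>An identity edge by edge. The halves turn the first function on the right into the
  midpoint, which has the prescribed values on \<open>A\<close> whenever \<open>u\<close> and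
  \<open>v\<close> do.\<close>

lemma energy_parallelogram:
  assumes "conductance_graph E c"
  shows "energy E c u + energy E c v =
    2 * energy E c (\<lambda>x. (u x + v x) / 2) + 2 * energy E c (\<lambda>x. (u x - v x) / 2)"
proof -
  let ?p = "\<lambda>x. (u x + v x) / 2" and ?m = "\<lambda>x. (u x - v x) / 2"
  have "ennreal (edge_energy c u e) + ennreal (edge_energy c v e) =
     (ennreal (edge_energy c ?p e) + ennreal (edge_energy c ?p e))
      + (ennreal (edge_energy c ?m e) + ennreal (edge_energy c ?m e))" if "e \<in> E" for e
  proof -
    obtain a b where e: "e = {a, b}" using conductance_graph_edgeE[OF assms(1) \<open>e \<in> E\<close>] by blast
    have "edge_energy c u e + edge_energy c v e =
      (edge_energy c ?p e + edge_energy c ?p e) + (edge_energy c ?m e + edge_energy c ?m e)"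
      unfolding e edge_energy_pair by (simp add: power2_eq_square field_simps)
    moreover have "0 \<le> edge_energy c f e" for f using assms that edge_energy_nonneg by blast
    ultimately show ?thesis by (simp flip: ennreal_plus)
  qed
  then have "(\<Sum>\<^sub>\<infinity>e\<in>E. ennreal (edge_energy c u e) + ennreal (edge_energy c v e)) =
    (\<Sum>\<^sub>\<infinity>e\<in>E. (ennreal (edge_energy c ?p e) + ennreal (edge_energy c ?p e))
      + (ennreal (edge_energy c ?m e) + ennreal (edge_energy c ?m e)))"
    by (rule infsum_cong)
  then show ?thesis unfolding energy_alt by (simp add: infsum_add mult_2 nonneg_summable_on_complete)
qed

text \<open>By local finiteness only finitely many edges meet the support. This supplies a
  competitor of finite energy, as cancellation in \<open>ennreal\<close> requires.\<close>

lemma energy_finite_support: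
  assumes "conductance_graph E c" "locally_finite_graph E" "finite {x. f x \<noteq> 0}"
  shows "energy E c f < \<infinity>"
proof -
  let ?F = "(\<Union>x\<in>{x. f x \<noteq> 0}. (\<lambda>y. {x, y}) ` nbrs E x)"
  have sub: "?F \<subseteq> E" by (auto simp: nbrs_def)
  have zero: "ennreal (edge_energy c f e) = 0" if "e \<in> E - ?F" for e
  proof -
    obtain a b where e: "e = {a, b}" using conductance_graph_edgeE[OF assms(1), of e] \<open>e \<in> E - ?F\<close> by blast
    have "{a, b} \<in> E" "{b, a} \<in> E" using that by (simp_all add: e insert_commute)
    then have "f a = 0" "f b = 0" using that unfolding e
      by (fastforce simp: nbrs_def insert_commute)+
    then show ?thesis unfolding e edge_energy_pair by simp
  qed
  have "energy E c f = (\<Sum>\<^sub>\<infinity>e\<in>?F. ennreal (edge_energy c f e))"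
    unfolding energy_alt by (rule infsum_cong_neutral) (use sub zero in auto)
  also have "\<dots> = (\<Sum>e\<in>?F. ennreal (edge_energy c f e))"
    using assms by (intro infsum_finite) (auto simp: locally_finite_graph_def)
  also have "\<dots> < \<infinity>" by (subst sum_ennreal) (use assms(1) sub edge_energy_nonneg in blast, simp)
  finally show ?thesis .
qed

lemma energy_zero_imp_const:
  assumes "conductance_graph E c" "connected_graph E" "energy E c f = 0"
  shows "f x = f y"
proof -
  have "f a = f b" if "{a, b} \<in> E" for a b
  proof -
    have "ennreal (\<Sum>e\<in>{{a, b}}. edge_energy c f e) \<le> 0"
      using sum_edge_energy_le_energy[OF assms(1), of "{{a, b}}" f] that assms(3) by simp
    then have "c {a, b} * (f a - f b)\<^sup>2 \<le> 0"
      by (simp add: edge_energy_pair ennreal_eq_0_iff)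
    then show ?thesis
      using conductance_graph_edgeD[OF assms(1) that] by (simp add: mult_le_0_iff)
  qed
  note edge = this
  have "(x, y) \<in> (adj_off E {})\<^sup>*" using assms(2) by (simp add: connected_graph_def)
  then show ?thesis
    by (induction rule: rtrancl_induct) (auto simp: adj_off_def dest: edge)
qed

text \<open>The midpoint of two minimizers is a competitor, so the parallelogram identity leaves no
  energy for half their difference; that difference is constant by connectedness and 0 on
  \<open>A\<close>.\<close>

lemma energy_minimizer_unique:
  assumes "conductance_graph E c" "locally_finite_graph E" "connected_graph E"
    and "finite A" "A \<noteq> {}" "energy_minimizer E c A \<phi> h" "energy_minimizer E c A \<phi> h'"
  shows "h = h'"
proof
  fix x
  let ?p = "\<lambda>x. (h x + h' x) / 2" and ?m = "\<lambda>x. (h x - h' x) / 2"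
  define f where "f = (\<lambda>a. if a \<in> A then \<phi> a else 0)"
  have "{x. f x \<noteq> 0} \<subseteq> A" by (auto simp: f_def)
  then have "energy E c f < \<infinity>"
    using assms by (intro energy_finite_support) (auto dest: finite_subset)
  moreover have "energy E c h \<le> energy E c f"
    using assms(6) by (auto simp: energy_minimizer_def f_def)
  ultimately have fin: "energy E c h < \<infinity>" by order
  have eq: "energy E c h' = energy E c h"
    using assms(6,7) unfolding energy_minimizer_def by (intro antisym) auto
  have "energy E c h \<le> energy E c ?p"
    using assms(6,7) unfolding energy_minimizer_def by auto
  then have "2 * energy E c h + 2 * energy E c ?m \<le> 2 * energy E c ?p + 2 * energy E c ?m"
    by (intro add_right_mono mult_left_mono) auto
  also have "\<dots> = 2 * energy E c h + 0"
    using energy_parallelogram[OF assms(1), of h h'] eq by (simp add: mult_2)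
  finally have "2 * energy E c h + 2 * energy E c ?m \<le> 2 * energy E c h + 0" .
  moreover have "2 * energy E c h \<noteq> \<infinity>" using fin by (simp add: ennreal_mult_eq_top_iff)
  ultimately have "2 * energy E c ?m \<le> 0"
    using ennreal_add_left_cancel_le by (metis infinity_ennreal_def)
  then have "energy E c ?m = 0" by simp
  moreover obtain a where "a \<in> A" using assms(5) by auto
  ultimately have "?m x = ?m a" using energy_zero_imp_const[of E c ?m x a] assms(1,3) by blast
  moreover have "h a = h' a" using assms(6,7) \<open>a \<in> A\<close> by (simp add: energy_minimizer_def)
  ultimately show "h x = h' x" by simp
qed

text \<open>By the parallelogram identity the increments along edges of a minimizing sequence are
  Cauchy, and energy is lower semicontinuous under pointwise convergence.\<close>

lemma energy_minimizer_exists: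
  assumes g: "conductance_graph E c" and "locally_finite_graph E" "connected_graph E"
    and "finite A" "A \<noteq> {}"
  shows "\<exists>h. energy_minimizer E c A \<phi> h"
proof -
  define S where "S = {f. \<forall>a\<in>A. f a = \<phi> a}"
  define m where "m = (INF f\<in>S. energy E c f)"
  define f0 where "f0 = (\<lambda>a. if a \<in> A then \<phi> a else 0)"
  have "{x. f0 x \<noteq> 0} \<subseteq> A" by (auto simp: f0_def)
  then have "energy E c f0 < \<infinity>"
    using assms by (intro energy_finite_support) (auto dest: finite_subset)
  moreover have "f0 \<in> S" by (auto simp: S_def f0_def)
  ultimately have mfin: "m < \<infinity>" unfolding m_def by (meson INF_lower le_less_trans)
  have mle: "m \<le> energy E c f" if "f \<in> S" for f using that by (auto simp: m_def INF_lower)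
  have "\<exists>f\<in>S. energy E c f < m + ennreal (1 / Suc n)" for n
  proof -
    have "m < m + ennreal (1 / Suc n)"
      using mfin by (cases m) (auto simp flip: ennreal_plus simp: ennreal_less_iff)
    then show ?thesis unfolding m_def by (subst (asm) INF_less_iff) auto
  qed
  then obtain f where fS: "\<And>n. f n \<in> S" and fm: "\<And>n. energy E c (f n) < m + ennreal (1 / Suc n)"
    by metis
  \<comment> \<open>Both energies exceed \<open>m\<close> by little while the midpoint costs at
    least \<open>m\<close>, so the half difference receives only the excess.\<close>
  have diff: "energy E c (\<lambda>x. (f n x - f k x) / 2) \<le> ennreal (1 / Suc n + 1 / Suc k)" for n k
  proof -
    let ?d = "energy E c (\<lambda>x. (f n x - f k x) / 2)"
    have "m \<le> energy E c (\<lambda>x. (f n x + f k x) / 2)"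
      using fS by (intro mle) (auto simp: S_def)
    then have "2 * m + 2 * ?d \<le> energy E c (f n) + energy E c (f k)"
      unfolding energy_parallelogram[OF g] by (intro add_mono mult_left_mono) auto
    also have "\<dots> \<le> (m + ennreal (1 / Suc n)) + (m + ennreal (1 / Suc k))"
      using fm by (intro add_mono less_imp_le)
    also have "\<dots> = 2 * m + ennreal (1 / Suc n + 1 / Suc k)"
      by (simp add: mult_2 add.assoc add.left_commute)
    finally have "2 * ?d \<le> ennreal (1 / Suc n + 1 / Suc k)"
      using mfin by (subst (asm) ennreal_add_left_cancel_le) (auto simp: ennreal_mult_eq_top_iff)
    moreover have "?d \<le> 2 * ?d" by (simp add: mult_2)
    ultimately show ?thesis by order
  qed
  have edge: "Cauchy (\<lambda>n. f n b - f n a)" if ab: "{a, b} \<in> E" for a b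
  proof (rule CauchyI)
    fix e :: real assume "0 < e"
    have c0: "0 < c {a, b}" using conductance_graph_edgeD[OF g ab] by simp
    \<comment> \<open>\<open>r\<close> is the energy of this edge for half a difference of two
      functions whose increments differ by \<open>e\<close>.\<close>
    define r where "r = c {a, b} * (e / 2)\<^sup>2"
    have "r > 0" using c0 \<open>0 < e\<close> by (simp add: r_def)
    then obtain N where N: "1 / real (Suc N) < r / 2"
      using nat_approx_posE[of "r / 2"] by auto
    have "norm ((f n b - f n a) - (f k b - f k a)) < e" if "n \<ge> N" "k \<ge> N" for n k
    proof -
      have "ennreal (edge_energy c (\<lambda>x. (f n x - f k x) / 2) {a, b}) \<le> ennreal (1 / Suc n + 1 / Suc k)"
        using order_trans[OF sum_edge_energy_le_energy[OF g, of "{{a, b}}"] diff[of n k]] ab by simp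
      then have "edge_energy c (\<lambda>x. (f n x - f k x) / 2) {a, b} \<le> 1 / Suc n + 1 / Suc k"
        by (subst (asm) ennreal_le_iff) auto
      also have "\<dots> \<le> 1 / Suc N + 1 / Suc N"
        using that by (intro add_mono) (auto simp: frac_le)
      also have "\<dots> < r" using N by simp
      finally have "c {a, b} * ((f n a - f k a) / 2 - (f n b - f k b) / 2)\<^sup>2 < c {a, b} * (e / 2)\<^sup>2"
        unfolding edge_energy_pair r_def .
      then have "\<bar>(f n a - f k a) / 2 - (f n b - f k b) / 2\<bar> < \<bar>e / 2\<bar>"
        using c0 by (simp only: mult_less_cancel_left_pos) (metis abs_le_square_iff not_le)
      then show ?thesis using \<open>0 < e\<close> by (simp add: abs_less_iff field_simps)
    qed
    then show "\<exists>N. \<forall>n\<ge>N. \<forall>k\<ge>N. norm ((f n b - f n a) - (f k b - f k a)) < e" by blast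
  qed
  \<comment> \<open>The values on \<open>A\<close> are fixed, and convergence spreads along a path
    from \<open>A\<close> because the increments converge.\<close>
  have "convergent (\<lambda>n. f n x)" for x
  proof -
    obtain a where "a \<in> A" using assms by auto
    then have fa: "\<And>n. f n a = \<phi> a" using fS by (auto simp: S_def)
    have "(a, x) \<in> (adj_off E {})\<^sup>*" using assms by (simp add: connected_graph_def)
    then show ?thesis
    proof (induction rule: rtrancl_induct)
      case base then show ?case by (simp add: fa convergent_const)
    next
      case (step y w)
      then have "convergent (\<lambda>n. f n w - f n y)"
        using edge by (intro real_Cauchy_convergent) (auto simp: adj_off_def)
      from convergent_add[OF this step.IH] show ?case by simp
    qed
  qed
  then obtain h where h: "\<And>x. (\<lambda>n. f n x) \<longlonglongrightarrow> h x"
    unfolding convergent_def by metis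
  have hS: "h \<in> S"
  proof -
    have "h a = \<phi> a" if "a \<in> A" for a
      using h[of a] fS that LIMSEQ_unique[of "\<lambda>n. f n a" "h a" "\<phi> a"] by (auto simp: S_def)
    then show ?thesis by (simp add: S_def)
  qed
  have "energy E c h \<le> m"
  proof (rule energy_leI[OF g])
    fix F assume F: "finite F" "F \<subseteq> E"
    have "(\<lambda>n. edge_energy c (f n) e) \<longlonglongrightarrow> edge_energy c h e" if "e \<in> E" for e
    proof -
      obtain a b where e: "e = {a, b}" using conductance_graph_edgeE[OF g \<open>e \<in> E\<close>] by blast
      show ?thesis unfolding e edge_energy_pair by (intro tendsto_intros h)
    qed
    then have "(\<lambda>n. \<Sum>e\<in>F. edge_energy c (f n) e) \<longlonglongrightarrow> (\<Sum>e\<in>F. edge_energy c h e)"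
      using F by (intro tendsto_sum) auto
    then have "(\<lambda>n. ennreal (\<Sum>e\<in>F. edge_energy c (f n) e)) \<longlonglongrightarrow> ennreal (\<Sum>e\<in>F. edge_energy c h e)"
      by (rule tendsto_ennrealI)
    moreover have "(\<lambda>n. m + ennreal (1 / Suc n)) \<longlonglongrightarrow> m + ennreal 0"
      by (intro tendsto_add tendsto_const tendsto_ennrealI LIMSEQ_Suc lim_1_over_n)
    moreover have "ennreal (\<Sum>e\<in>F. edge_energy c (f n) e) \<le> m + ennreal (1 / Suc n)" for n
      using order_trans[OF sum_edge_energy_le_energy[OF g F] less_imp_le[OF fm]] .
    ultimately show "ennreal (\<Sum>e\<in>F. edge_energy c h e) \<le> m"
      using LIMSEQ_le by fastforce
  qed
  then have "energy_minimizer E c A \<phi> h"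
    using hS mle unfolding energy_minimizer_def S_def by fastforce
  then show ?thesis by blast
qed

section \<open>Components off a finite set and minimizers vanishing on them\<close>

lemma components_off_edge:
  assumes "C \<in> components_off E A" "x \<in> C" "{x, y} \<in> E" "y \<notin> A"
  shows "y \<in> C"
proof -
  obtain v where v: "v \<notin> A" "C = {y. (v, y) \<in> (adj_off E A)\<^sup>*}"
    using assms(1) by (auto simp: components_off_def)
  then have "(v, x) \<in> (adj_off E A)\<^sup>*" using assms by auto
  moreover from this v have "x \<notin> A"
    by (induction rule: rtrancl_induct) (auto simp: adj_off_def)
  ultimately show ?thesis using assms v
    by (auto simp: adj_off_def intro: rtrancl_into_rtrancl)
qed

text \<open>Multiplying the minimizer by the indicator of the complement of \<open>C\<close> does not increase its
  energy, as it vanishes on all neighbours of \<open>C\<close> outside \<open>C\<close>.\<close>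

lemma components_off_disjoint:
  assumes "C \<in> components_off E A"
  shows "C \<inter> A = {}"
proof -
  obtain v where v: "v \<notin> A" "C = {y. (v, y) \<in> (adj_off E A)\<^sup>*}"
    using assms by (auto simp: components_off_def)
  have "y \<notin> A" if "(v, y) \<in> (adj_off E A)\<^sup>*" for y
    using that v(1) by (induction rule: rtrancl_induct) (auto simp: adj_off_def)
  then show ?thesis using v by auto
qed

lemma energy_min_extension_eq_0:
  assumes g: "conductance_graph E c" and "locally_finite_graph E" "connected_graph E"
    and "finite A" "finite B" "A \<union> B \<noteq> {}"
    and C: "C \<in> components_off E A" "x \<in> C" "C \<inter> B = {}"
    and \<phi>: "\<And>a. a \<in> A \<Longrightarrow> \<phi> a = 0"
  shows "energy_min_extension E c (A \<union> B) \<phi> x = 0"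
proof -
  let ?D = "A \<union> B"
  obtain h where h: "energy_minimizer E c ?D \<phi> h"
    using energy_minimizer_exists[of E c ?D \<phi>] assms by auto
  define h' where "h' = (\<lambda>v. if v \<in> C then 0 else h v)"
  have on_D: "\<forall>a\<in>?D. h a = \<phi> a" using h by (simp add: energy_minimizer_def)
  then have h'_D: "\<forall>a\<in>?D. h' a = \<phi> a"
    using C components_off_disjoint[OF C(1)] by (auto simp: h'_def)
  have "energy E c h' \<le> energy E c h"
  proof (rule energy_mono)
    fix e assume "e \<in> E"
    then obtain a b where e: "e = {a, b}" using g by (blast elim: conductance_graph_edgeE)
    \<comment> \<open>A neighbour of \<open>C\<close> outside \<open>C\<close> must lie in
      \<open>A\<close>, where the boundary value is 0; hence the increment of \<open>h'\<close>
      across the boundary of \<open>C\<close> is 0.\<close>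
    have "h v = 0" if "u \<in> C" "v \<notin> C" "{u, v} \<in> E" for u v
      using components_off_edge[OF C(1)] that on_D \<phi> by fastforce
    then have "(h' a - h' b)\<^sup>2 \<le> (h a - h b)\<^sup>2"
      using \<open>e \<in> E\<close> unfolding e h'_def by (auto simp: insert_commute)
    then show "edge_energy c h' e \<le> edge_energy c h e"
      using g \<open>e \<in> E\<close> unfolding e edge_energy_pair
      by (intro mult_left_mono) (auto simp: conductance_graph_def less_imp_le)
  qed
  then have "energy_minimizer E c ?D \<phi> h'"
    using h h'_D unfolding energy_minimizer_def by (blast intro: order_trans)
  moreover have "finite ?D" using assms by simp
  ultimately have "(THE h. energy_minimizer E c ?D \<phi> h) = h'"
    using energy_minimizer_unique[OF assms(1-3) _ assms(6)] by (intro the_equality)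
  then show ?thesis using C by (simp add: energy_min_extension_def h'_def)
qed

section \<open>Components and ends\<close>

lemma components_off_same:
  assumes "C \<in> components_off E A" "C' \<in> components_off E A" "x \<in> C" "x \<in> C'"
  shows "C = C'"
proof -
  have eq: "D = {y. (x, y) \<in> (adj_off E A)\<^sup>*}" if "D \<in> components_off E A" "x \<in> D" for D
  proof -
    obtain v where D: "D = {y. (v, y) \<in> (adj_off E A)\<^sup>*}"
      using \<open>D \<in> components_off E A\<close> by (auto simp: components_off_def)
    have "sym ((adj_off E A)\<^sup>*)"
      by (intro sym_rtrancl) (auto simp: adj_off_def sym_def insert_commute)
    then show ?thesis
      using \<open>x \<in> D\<close> unfolding D by (auto dest: symD intro: rtrancl_trans)
  qed
  show ?thesis using eq[of C] eq[of C'] assms by simp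
qed

lemma components_off_nonempty: "C \<in> components_off E A \<Longrightarrow> C \<noteq> {}"
  by (auto simp: components_off_def)

lemma components_off_cover:
  assumes "x \<notin> A"
  obtains C where "C \<in> components_off E A" "x \<in> C"
  using assms that[of "{y. (x, y) \<in> (adj_off E A)\<^sup>*}"] by (auto simp: components_off_def)

section \<open>Tails of rays and evaluation of ends\<close>

lemma ray_eventually_off:
  assumes "P \<in> rays E" "finite A"
  shows "\<forall>\<^sub>F k in sequentially. P k \<notin> A"
proof -
  have "finite (P -` A)" using assms by (intro finite_vimageI) (auto simp: rays_def)
  then obtain m where "\<And>k. k \<in> P -` A \<Longrightarrow> k \<le> m"
    using finite_nat_set_iff_bounded_le[of "P -` A"] by auto
  then have "\<forall>k>m. P k \<notin> A" by (meson not_le vimageI2)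
  then show ?thesis unfolding eventually_at_top_dense by blast
qed

text \<open>Injectivity makes the ray leave \<open>A\<close> for good; from then on successive
  vertices are adjacent off \<open>A\<close>.\<close>

lemma ray_eventually_component:
  assumes "P \<in> rays E" "finite A"
  obtains C where "C \<in> components_off E A" "\<forall>\<^sub>F k in sequentially. P k \<in> C"
proof -
  obtain N where N: "\<And>k. k \<ge> N \<Longrightarrow> P k \<notin> A"
    using ray_eventually_off[OF assms] by (auto simp: eventually_sequentially)
  obtain C where C: "C \<in> components_off E A" "P N \<in> C"
    using components_off_cover[OF N[of N]] by auto
  have "P k \<in> C" if "k \<ge> N" for k
    using that
  proof (induction k rule: dec_induct)
    case (step k)
    then show ?case
      using components_off_edge[OF C(1), of "P k" "P (Suc k)"] N[of "Suc k"] assms(1)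
      by (auto simp: rays_def)
  qed (use C in auto)
  then show ?thesis using that C by (auto simp: eventually_sequentially)
qed

lemma ray_eventually_infinite:
  assumes "P \<in> rays E" "\<forall>\<^sub>F k in sequentially. P k \<in> C"
  shows "infinite (C \<inter> range P)"
proof -
  obtain N where N: "\<And>k. k \<ge> N \<Longrightarrow> P k \<in> C"
    using assms by (auto simp: eventually_sequentially)
  have "inj_on P {N..}" using assms(1) by (auto simp: rays_def intro: inj_on_subset)
  then have "infinite (P ` {N..})" by (simp add: finite_image_iff infinite_Ici)
  moreover have "P ` {N..} \<subseteq> C \<inter> range P" using N by auto
  ultimately show ?thesis using finite_subset by blast
qed

text \<open>The tail settles in one component, so meeting a component infinitely often means staying
  in it. This replaces the cardinality conditions in the definition of ends by
  \<open>eventually\<close>, which is closed under conjunction.\<close>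

lemma ray_infinite_component_iff:
  assumes "P \<in> rays E" "finite A" "C \<in> components_off E A"
  shows "infinite (C \<inter> range P) \<longleftrightarrow> (\<forall>\<^sub>F k in sequentially. P k \<in> C)"
proof
  assume inf: "infinite (C \<inter> range P)"
  obtain C' where C': "C' \<in> components_off E A" "\<forall>\<^sub>F k in sequentially. P k \<in> C'"
    using ray_eventually_component[OF assms(1,2)] by blast
  then obtain N where N: "\<And>k. k \<ge> N \<Longrightarrow> P k \<in> C'" by (auto simp: eventually_sequentially)
  have "\<not> C \<inter> range P \<subseteq> P ` {..<N}" using inf finite_subset by blast
  then obtain k where "k \<ge> N" "P k \<in> C" by (auto simp: image_iff) (metis lessThan_iff not_le)
  then have "C = C'" using components_off_same[OF assms(3) C'(1)] N by blast
  then show "\<forall>\<^sub>F k in sequentially. P k \<in> C" using C' by simp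
qed (use ray_eventually_infinite assms in blast)

text \<open>Unique existence reduces to existence, as two components containing tails of the same
  ray intersect.\<close>

lemma ray_rel_iff:
  "(P, Q) \<in> ray_rel E \<longleftrightarrow> P \<in> rays E \<and> Q \<in> rays E \<and>
    (\<forall>A. finite A \<longrightarrow> (\<exists>C\<in>components_off E A.
      (\<forall>\<^sub>F k in sequentially. P k \<in> C) \<and> (\<forall>\<^sub>F k in sequentially. Q k \<in> C)))"
proof -
  have "(\<exists>!C. C \<in> components_off E A \<and> infinite (C \<inter> range P) \<and> infinite (C \<inter> range Q)) \<longleftrightarrow>
     (\<exists>C\<in>components_off E A.
      (\<forall>\<^sub>F k in sequentially. P k \<in> C) \<and> (\<forall>\<^sub>F k in sequentially. Q k \<in> C))"
    if "P \<in> rays E" "Q \<in> rays E" "finite A" for A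
  proof -
    have "C = C'" if "C \<in> components_off E A" "C' \<in> components_off E A"
       "\<forall>\<^sub>F k in sequentially. P k \<in> C" "\<forall>\<^sub>F k in sequentially. P k \<in> C'" for C C'
      using eventually_happens[OF eventually_conj[OF that(3,4)]] components_off_same[OF that(1,2)]
      by auto
    then have "(\<exists>!C. C \<in> components_off E A \<and> (\<forall>\<^sub>F k in sequentially. P k \<in> C) \<and>
        (\<forall>\<^sub>F k in sequentially. Q k \<in> C)) \<longleftrightarrow>
      (\<exists>C\<in>components_off E A. (\<forall>\<^sub>F k in sequentially. P k \<in> C) \<and>
        (\<forall>\<^sub>F k in sequentially. Q k \<in> C))" by blast
    then show ?thesis
      using that by (simp add: ray_infinite_component_iff cong: conj_cong)
  qed
  then show ?thesis unfolding ray_rel_def mem_Collect_eq case_prod_conv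
    by (simp only: cong: conj_cong imp_cong)
qed

lemma ray_rel_eventually:
  assumes "(P, Q) \<in> ray_rel E" "finite A" "C \<in> components_off E A"
    "\<forall>\<^sub>F k in sequentially. P k \<in> C"
  shows "\<forall>\<^sub>F k in sequentially. Q k \<in> C"
proof -
  obtain C' where C': "C' \<in> components_off E A" "\<forall>\<^sub>F k in sequentially. P k \<in> C'"
    "\<forall>\<^sub>F k in sequentially. Q k \<in> C'"
    using assms(1,2) by (auto simp: ray_rel_iff)
  have "C = C'"
    using eventually_happens[OF eventually_conj[OF assms(4) C'(2)]]
      components_off_same[OF assms(3) C'(1)] by auto
  then show ?thesis using C' by simp
qed

lemma equiv_ray_rel: "equiv (rays E) (ray_rel E)"
proof (rule equivI)
  show "ray_rel E \<subseteq> rays E \<times> rays E" by (auto simp: ray_rel_iff)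
  show "refl_on (rays E) (ray_rel E)"
    by (auto simp: refl_on_def ray_rel_iff) (metis ray_eventually_component)
  show "sym (ray_rel E)" by (auto simp: sym_def ray_rel_iff)
  show "trans (ray_rel E)"
  proof (rule transI)
    fix P Q R assume *: "(P, Q) \<in> ray_rel E" "(Q, R) \<in> ray_rel E"
    show "(P, R) \<in> ray_rel E"
      unfolding ray_rel_iff
    proof (intro conjI allI impI)
      fix A :: "'a set" assume "finite A"
      then obtain C where "C \<in> components_off E A" "\<forall>\<^sub>F k in sequentially. P k \<in> C"
        "\<forall>\<^sub>F k in sequentially. Q k \<in> C"
        using * by (auto simp: ray_rel_iff)
      then show "\<exists>C\<in>components_off E A. (\<forall>\<^sub>F k in sequentially. P k \<in> C) \<and>
        (\<forall>\<^sub>F k in sequentially. R k \<in> C)"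
        using ray_rel_eventually[OF *(2) \<open>finite A\<close>] by blast
    qed (use * in \<open>auto simp: ray_rel_iff\<close>)
  qed
qed

text \<open>Evaluates the definite description from one representative: equivalent rays share the
  component of its tail, and since \<open>P\<close> lies in its own class no second component
  qualifies.\<close>

lemma end_component_eq:
  assumes "P \<in> rays E" "finite A" "C \<in> components_off E A" "\<forall>\<^sub>F k in sequentially. P k \<in> C"
  shows "end_component E A (ray_rel E `` {P}) = C"
  unfolding end_component_def
proof (rule the_equality)
  have "infinite (C \<inter> range Q)" if "(P, Q) \<in> ray_rel E" for Q
  proof -
    have "Q \<in> rays E" using that by (simp add: ray_rel_def)
    then show ?thesis
      using ray_eventually_infinite ray_rel_eventually[OF that assms(2-4)] by blast
  qed
  then show "C \<in> components_off E A \<and> (\<forall>Q\<in>ray_rel E `` {P}. infinite (C \<inter> range Q))"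
    using assms(3) by simp
next
  fix C' assume C': "C' \<in> components_off E A \<and> (\<forall>Q\<in>ray_rel E `` {P}. infinite (C' \<inter> range Q))"
  have "P \<in> ray_rel E `` {P}" using equiv_class_self[OF equiv_ray_rel] assms(1) by metis
  then have "\<forall>\<^sub>F k in sequentially. P k \<in> C'"
    using C' assms ray_infinite_component_iff by blast
  from eventually_happens[OF eventually_conj[OF assms(4) this]] show "C' = C"
    using components_off_same[OF assms(3), of C'] C' by auto
qed

text \<open>A choice of components that decreases as the removed finite set grows is realised by a ray
  which is geodesic from a base point \<open>r\<close>: along \<open>D\<close> the distance \<open>d\<close> to \<open>r\<close> increases by one,
  and Koenig's lemma is applied to the vertices having \<open>D\<close>-descendants in all the chosen
  components.\<close>

lemma direction_ray:
  assumes "connected_graph E" and lf: "locally_finite_graph E"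
    and C: "\<And>A. finite A \<Longrightarrow> C A \<in> components_off E A"
    and mono: "\<And>A B. finite B \<Longrightarrow> A \<subseteq> B \<Longrightarrow> C B \<subseteq> C A"
  obtains P where "P \<in> rays E" "\<And>A. finite A \<Longrightarrow> \<forall>\<^sub>F k in sequentially. P k \<in> C A"
proof -
  fix r :: 'a
  let ?R = "adj_off E {}"
  define d where "d x = (LEAST n. (r, x) \<in> ?R ^^ n)" for x
  have "\<exists>n. (r, x) \<in> ?R ^^ n" for x
    using assms(1) rtrancl_imp_relpow by (fastforce simp: connected_graph_def)
  then have d: "(r, x) \<in> ?R ^^ d x" for x unfolding d_def by (rule LeastI_ex)
  have d_le: "d x \<le> n" if "(r, x) \<in> ?R ^^ n" for x n unfolding d_def using that by (rule Least_le)
  have d_r: "d r = 0" using d_le[of r 0] by simp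
  define D where "D = {(u, v). {u, v} \<in> E \<and> d v = Suc (d u)}"
  have pred: "\<exists>u. (u, x) \<in> D" if "d x = Suc n" for x n
  proof -
    obtain u where u: "(r, u) \<in> ?R ^^ n" "(u, x) \<in> ?R" using d[of x] \<open>d x = Suc n\<close> by auto
    then have "d u \<le> n" by (intro d_le)
    moreover have "(r, x) \<in> ?R ^^ Suc (d u)" using d[of u] u by auto
    then have "d x \<le> Suc (d u)" by (rule d_le)
    ultimately show ?thesis using that u by (auto simp: D_def adj_off_def)
  qed
  have D_r: "(r, x) \<in> D\<^sup>*" for x
  proof (induction "d x" arbitrary: x)
    case 0
    then show ?case using d[of x] by simp
  next
    case (Suc n)
    then obtain u where u: "(u, x) \<in> D" using pred by metis
    then have "(r, u) \<in> D\<^sup>*" using Suc by (auto simp: D_def)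
    then show ?case using u by auto
  qed
  define ball where "ball n = {x. d x \<le> n}" for n
  have fin: "finite (ball n)" for n
  proof (induction n)
    case 0
    have "x = r" if "d x = 0" for x using d[of x] that by simp
    then have "ball 0 \<subseteq> {r}" by (auto simp: ball_def)
    then show ?case using finite_subset by blast
  next
    case (Suc n)
    have "ball (Suc n) \<subseteq> ball n \<union> (\<Union>u\<in>ball n. nbrs E u)"
    proof
      fix x assume "x \<in> ball (Suc n)"
      then consider "x \<in> ball n" | "d x = Suc n" by (auto simp: ball_def le_Suc_eq)
      then show "x \<in> ball n \<union> (\<Union>u\<in>ball n. nbrs E u)"
      proof cases
        case 2
        then obtain u where "(u, x) \<in> D" using pred by blast
        then show ?thesis using 2 by (auto simp: D_def ball_def nbrs_def)
      qed simp
    qed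
    moreover have "finite (ball n \<union> (\<Union>u\<in>ball n. nbrs E u))"
      using Suc lf by (auto simp: locally_finite_graph_def)
    ultimately show ?case by (rule finite_subset)
  qed
  define good where "good v \<longleftrightarrow> (\<forall>n. \<exists>x\<in>C (ball n). (v, x) \<in> D\<^sup>*)" for v
  have "good r"
    unfolding good_def using D_r components_off_nonempty[OF C[OF fin]] by blast
  have step: "\<exists>v'. (v, v') \<in> D \<and> good v'" if "good v" for v
  proof (rule ccontr)
    assume "\<nexists>v'. (v, v') \<in> D \<and> good v'"
    then have "\<forall>v'. \<exists>n. (v, v') \<in> D \<longrightarrow> (\<forall>x\<in>C (ball n). (v', x) \<notin> D\<^sup>*)"
      by (auto simp: good_def)
    then obtain n where n: "\<And>v' x. (v, v') \<in> D \<Longrightarrow> x \<in> C (ball (n v')) \<Longrightarrow> (v', x) \<notin> D\<^sup>*"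
      by metis
    \<comment> \<open>The sum dominates the level at which each \<open>D\<close>-successor of
      \<open>v\<close> fails, so one ball serves for all of them; the summand \<open>d v\<close>
      puts \<open>v\<close> into the ball and so excludes \<open>x = v\<close>.\<close>
    define N where "N = d v + (\<Sum>u\<in>nbrs E v. n u)"
    obtain x where x: "x \<in> C (ball N)" "(v, x) \<in> D\<^sup>*" using \<open>good v\<close> by (auto simp: good_def)
    have "x \<notin> ball N" using components_off_disjoint[OF C[OF fin]] x by blast
    then have "x \<noteq> v" by (auto simp: ball_def N_def)
    then obtain v' where v': "(v, v') \<in> D" "(v', x) \<in> D\<^sup>*" using x by (metis converse_rtranclE)
    have "n v' \<le> N"
      using v' lf by (auto simp: N_def D_def nbrs_def locally_finite_graph_def
          intro!: trans_le_add2 member_le_sum)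
    then have "C (ball N) \<subseteq> C (ball (n v'))" by (intro mono fin) (auto simp: ball_def)
    then show False using n v' x by blast
  qed
  obtain P where P: "P 0 = r" "\<And>n. good (P n)" "\<And>n. (P n, P (Suc n)) \<in> D"
    using dependent_nat_choice[of "\<lambda>n v. good v \<and> (n = 0 \<longrightarrow> v = r)" "\<lambda>_ v v'. (v, v') \<in> D"]
      \<open>good r\<close> step by auto
  have dP: "d (P n) = n" for n
  proof (induction n)
    case (Suc n)
    then show ?case using P(3)[of n] by (simp add: D_def)
  qed (simp add: P d_r)
  have ray: "P \<in> rays E"
    using P(3) dP unfolding rays_def by (auto simp: D_def intro: inj_on_inverseI)
  have late: "P n \<in> C (ball m)" if "m < n" for m n
  proof -
    obtain x where x: "x \<in> C (ball m)" "(P n, x) \<in> D\<^sup>*" using P(2)[of n] unfolding good_def by blast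
    \<comment> \<open>The distance grows along \<open>D\<close>, so the whole \<open>D\<close>-path
      from \<open>v\<close> to \<open>x\<close> avoids the ball and stays in the component of
      \<open>x\<close>.\<close>
    have "v \<in> C (ball m)" if "(v, x) \<in> D\<^sup>*" "m < d v" for v
      using that
    proof (induction rule: converse_rtrancl_induct)
      case base
      then show ?case using x by simp
    next
      case (step y v)
      then have "v \<in> C (ball m)" "{v, y} \<in> E" "y \<notin> ball m"
        by (auto simp: D_def ball_def insert_commute)
      then show ?case using components_off_edge[OF C[OF fin]] by blast
    qed
    then show ?thesis using x dP that by simp
  qed
  show ?thesis
  proof (rule that[OF ray])
    fix A :: "'a set" assume A: "finite A"
    \<comment> \<open>Serves as an upper bound for the distances on \<open>A\<close> that also makes
      sense for empty \<open>A\<close>.\<close>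
    define m where "m = (\<Sum>x\<in>A. d x)"
    have "A \<subseteq> ball m" using A by (auto simp: ball_def m_def intro: member_le_sum)
    then have "C (ball m) \<subseteq> C A" using mono fin by blast
    then show "\<forall>\<^sub>F k in sequentially. P k \<in> C A"
      using late by (auto simp: eventually_at_top_dense)
  qed
qed

text \<open>Only nonempty \<open>A\<close> are tested because the members of an exhaustion are
  nonempty. A ray of any other candidate end has its tails in the same components as
  \<open>P\<close>, which is equivalence.\<close>

lemma direction_end:
  assumes "connected_graph E" and "locally_finite_graph E"
    and C: "\<And>A. finite A \<Longrightarrow> C A \<in> components_off E A"
    and mono: "\<And>A B. finite B \<Longrightarrow> A \<subseteq> B \<Longrightarrow> C B \<subseteq> C A"
  shows "\<exists>!\<xi>. \<xi> \<in> ends E \<and> (\<forall>A. finite A \<and> A \<noteq> {} \<longrightarrow> end_component E A \<xi> = C A)"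
proof -
  obtain P where P: "P \<in> rays E" "\<And>A. finite A \<Longrightarrow> \<forall>\<^sub>F k in sequentially. P k \<in> C A"
    using direction_ray assms by blast
  show ?thesis
  proof (intro ex1I[of _ "ray_rel E `` {P}"] conjI allI impI; (elim conjE)?)
    show "ray_rel E `` {P} \<in> ends E" using P by (simp add: ends_def quotientI)
    show "end_component E A (ray_rel E `` {P}) = C A" if "finite A" for A
      using end_component_eq that P C by blast
  next
    fix \<xi> assume "\<xi> \<in> ends E" and eq: "\<forall>A. finite A \<and> A \<noteq> {} \<longrightarrow> end_component E A \<xi> = C A"
    then obtain Q where Q: "Q \<in> rays E" "\<xi> = ray_rel E `` {Q}"
      by (auto simp: ends_def quotient_def)
    have ne: "\<forall>\<^sub>F k in sequentially. Q k \<in> C A" if "finite A" "A \<noteq> {}" for A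
    proof -
      obtain K where K: "K \<in> components_off E A" "\<forall>\<^sub>F k in sequentially. Q k \<in> K"
        by (rule ray_eventually_component[OF Q(1) \<open>finite A\<close>])
      have "end_component E A \<xi> = C A" using eq \<open>finite A\<close> \<open>A \<noteq> {}\<close> by blast
      then have "C A = K" using end_component_eq[OF Q(1) \<open>finite A\<close> K] Q(2) by metis
      then show ?thesis using K by simp
    qed
    have "\<forall>\<^sub>F k in sequentially. Q k \<in> C A" if "finite A" for A
    \<comment> \<open>The empty set is recovered by monotonicity from an arbitrary
      singleton.\<close>
    proof (cases "A = {}")
      case True
      have "C {undefined} \<subseteq> C A" using mono True by simp
      then show ?thesis using ne[of "{undefined}"] by (simp add: eventually_mono subset_iff)
    qed (use ne that in auto)
    then have "(Q, P) \<in> ray_rel E" using P Q(1) C unfolding ray_rel_iff by blast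
    then show "\<xi> = ray_rel E `` {P}" unfolding Q(2) by (rule equiv_class_eq[OF equiv_ray_rel])
  qed
qed

lemma components_off_mono:
  assumes "A \<subseteq> B" "C \<in> components_off E A" "D \<in> components_off E B" "x \<in> C" "x \<in> D"
  shows "D \<subseteq> C"
proof -
  have "C = {y. (x, y) \<in> (adj_off E A)\<^sup>*}"
    using assms components_off_disjoint[OF assms(2)]
    by (intro components_off_same[OF assms(2), of _ x]) (auto simp: components_off_def)
  moreover have "D = {y. (x, y) \<in> (adj_off E B)\<^sup>*}"
    using assms components_off_disjoint[OF assms(3)]
    by (intro components_off_same[OF assms(3), of _ x]) (auto simp: components_off_def)
  moreover have "(adj_off E B)\<^sup>* \<subseteq> (adj_off E A)\<^sup>*"
    using assms(1) by (intro rtrancl_mono) (auto simp: adj_off_def)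
  ultimately show ?thesis by blast
qed

section \<open>Trajectories at infinity\<close>

text \<open>Phrased through an attained time instead of an infimum, so that a restart is just a time
  shift. It records that the stay ends at a vertex and not at infinity.\<close>

definition exits_to_vertex :: "'v \<Rightarrow> (real \<Rightarrow> 'v option) \<Rightarrow> bool" where
  "exits_to_vertex x p \<longleftrightarrow>
    (\<exists>s>0. p s \<noteq> Some x \<and> p s \<noteq> None \<and> (\<forall>u. 0 < u \<and> u < s \<longrightarrow> p u = Some x))"

text \<open>For \<open>B = A\<close> this is attainment of the hitting time of \<open>A\<close>; for
  \<open>B = insert y A\<close> with \<open>y\<close> outside \<open>A\<close> it says that
  \<open>A\<close> is reached before \<open>y\<close>.\<close>

definition hits_avoiding :: "'v set \<Rightarrow> 'v set \<Rightarrow> (real \<Rightarrow> 'v option) \<Rightarrow> bool" where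
  "hits_avoiding A B p \<longleftrightarrow>
    (\<exists>s\<ge>0. p s \<in> Some ` A \<and> (\<forall>u. 0 \<le> u \<and> u < s \<longrightarrow> p u \<notin> Some ` B))"

definition exits_before :: "real \<Rightarrow> 'v \<Rightarrow> (real \<Rightarrow> 'v option) \<Rightarrow> real set" where
  "exits_before T x p = {e. 0 < e \<and> e \<le> T \<and> p e \<noteq> Some x \<and>
     (\<exists>s\<ge>0. s < e \<and> (\<forall>u\<in>{s..<e}. p u = Some x))}"

lemma exits_to_vertex_restrict: "exits_to_vertex x (restrict p {0..}) \<longleftrightarrow> exits_to_vertex x p"
  unfolding exits_to_vertex_def by (intro ex_cong1) auto

lemma hits_avoiding_restrict: "hits_avoiding A B (restrict p {0..}) \<longleftrightarrow> hits_avoiding A B p"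
  unfolding hits_avoiding_def by (intro ex_cong1) auto

text \<open>The trajectory properties from which the conclusion follows without probability. Except
  for \<open>right\<close>, which the walk has at all times at once, they range over countable data:
  rationals, vertices, finite sets and natural horizons.\<close>

locale good_trajectory =
  fixes E :: "'v set set" and p :: "real \<Rightarrow> 'v option"
  assumes rat: "q \<in> \<rat> \<Longrightarrow> 0 \<le> q \<Longrightarrow> p q \<noteq> None"
    and right: "0 \<le> t \<Longrightarrow> p t \<noteq> None \<Longrightarrow> \<exists>\<epsilon>>0. \<forall>s\<in>{t..t+\<epsilon>}. p s = p t"
    and ex: "q \<in> \<rat> \<Longrightarrow> 0 \<le> q \<Longrightarrow> p q = Some x \<Longrightarrow> exits_to_vertex x (\<lambda>s. p (s + q))"
    and hit: "q \<in> \<rat> \<Longrightarrow> 0 \<le> q \<Longrightarrow> hits_avoiding {x} {x} (\<lambda>s. p (s + q))"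
    and cross: "q \<in> \<rat> \<Longrightarrow> 0 \<le> q \<Longrightarrow> finite A \<Longrightarrow> C \<in> components_off E A \<Longrightarrow> x \<in> C \<Longrightarrow>
       y \<notin> C \<Longrightarrow> y \<notin> A \<Longrightarrow> p q = Some x \<Longrightarrow> hits_avoiding A (insert y A) (\<lambda>s. p (s + q))"
    and fin: "finite (exits_before (real T) x p)"
begin

text \<open>\<open>ex\<close> speaks of rational times only; by \<open>right\<close> the stay lasts
  up to a rational \<open>q\<close>, and the exit after \<open>q\<close> is the exit after
  \<open>s\<close>.\<close>

lemma next_exit:
  assumes "0 \<le> s" "p s = Some x"
  obtains e where "s < e" "p e \<noteq> Some x" "p e \<noteq> None" "\<And>u. s \<le> u \<Longrightarrow> u < e \<Longrightarrow> p u = Some x"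
proof -
  obtain \<epsilon> where \<epsilon>: "\<epsilon> > 0" "\<And>u. u \<in> {s..s+\<epsilon>} \<Longrightarrow> p u = Some x"
    using right[OF assms(1)] assms by force
  obtain q where q: "q \<in> \<rat>" "s < q" "q < s + \<epsilon>" using Rats_dense_in_real[of s "s + \<epsilon>"] \<epsilon> by auto
  then obtain r where r: "r > 0" "p (r + q) \<noteq> Some x" "p (r + q) \<noteq> None"
     "\<And>u. 0 < u \<Longrightarrow> u < r \<Longrightarrow> p (u + q) = Some x"
    using ex[of q x] \<epsilon> assms(1) by (auto simp: exits_to_vertex_def)
  have "p u = Some x" if "s \<le> u" "u < r + q" for u
    using \<epsilon>(2)[of u] r(4)[of "u - q"] that q by (cases "u \<le> q") auto
  then show ?thesis using that[of "r + q"] r q by auto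
qed

lemma no_visit_vertex:
  assumes "0 \<le> t" and t: "p t = None"
  shows "\<exists>\<delta>>0. \<forall>s\<ge>0. \<bar>s - t\<bar> < \<delta> \<longrightarrow> p s \<noteq> Some x"
proof (rule ccontr)
  assume "\<not> ?thesis"
  then have acc: "\<exists>s\<ge>0. \<bar>s - t\<bar> < \<delta> \<and> p s = Some x" if "\<delta> > 0" for \<delta> using that by blast
  have "t > 0" using assms rat[of 0] by (cases "t = 0") auto
  obtain T :: nat where T: "t + 1 \<le> T" using real_arch_simple by blast
  obtain \<delta>0 where \<delta>0: "\<delta>0 > 0" "\<And>e. e \<in> exits_before T x p \<Longrightarrow> e \<noteq> t \<Longrightarrow> \<delta>0 \<le> dist t e"
    using finite_set_avoid[OF fin, of T x t] by blast
  \<comment> \<open>The bound \<open>t\<close> keeps the window at nonnegative times, 1 keeps its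
    exits below the horizon \<open>T\<close>, and \<open>\<delta>0\<close> separates them from
    \<open>t\<close>.\<close>
  define \<delta> where "\<delta> = min \<delta>0 (min t 1)"
  have \<delta>: "\<delta> > 0" "\<delta> \<le> t" "\<delta> \<le> 1" "\<delta> \<le> \<delta>0" using \<delta>0 \<open>t > 0\<close> by (auto simp: \<delta>_def)
  \<comment> \<open>\<open>\<delta>0\<close> controls only exits different from \<open>t\<close>; an
    exit to a vertex cannot happen at \<open>t\<close>, where the state is
    \<open>None\<close>.\<close>
  have noexit: "t + \<delta> \<le> e"
    if "0 \<le> s" "t - \<delta> < s" "s < e" "p e \<noteq> Some x" "p e \<noteq> None" "\<And>u. s \<le> u \<Longrightarrow> u < e \<Longrightarrow> p u = Some x"
    for s e
  proof (rule ccontr)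
    assume e: "\<not> t + \<delta> \<le> e"
    then have "e \<in> exits_before T x p"
      using that \<delta> T unfolding exits_before_def by (auto intro!: exI[of _ s])
    moreover have "e \<noteq> t" using that t by auto
    ultimately have "\<delta> \<le> \<bar>t - e\<bar>" using \<delta>0(2)[of e] \<delta> by (simp add: dist_real_def)
    then show False using that e by (simp add: abs_if split: if_splits)
  qed
  \<comment> \<open>A stay begun here has no exit in the window and would therefore cover
    \<open>t\<close>.\<close>
  have left: "p s \<noteq> Some x" if "t - \<delta> < s" "s \<le> t" for s
  proof
    assume s: "p s = Some x"
    then obtain e where e: "s < e" "p e \<noteq> Some x" "p e \<noteq> None" "\<And>u. s \<le> u \<Longrightarrow> u < e \<Longrightarrow> p u = Some x"
      using next_exit[of s x] \<open>t - \<delta> < s\<close> \<delta> by auto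
    then have "t + \<delta> \<le> e" using noexit[of s e] that \<delta> by auto
    then show False using e(4)[of t] t that \<delta> by auto
  qed
  \<comment> \<open>Visits accumulate at \<open>t\<close> and none lies to the left, so one falls
    between \<open>t\<close> and \<open>u\<close>; having no exit in the window, its stay covers
    \<open>u\<close>.\<close>
  have rgt: "p u = Some x" if "t < u" "u < t + \<delta>" for u
  proof -
    obtain s where s: "0 \<le> s" "\<bar>s - t\<bar> < \<delta>" "\<bar>s - t\<bar> < u - t" "p s = Some x"
      using acc[of "min \<delta> (u - t)"] \<open>t < u\<close> \<delta> by auto
    have "t < s" "s < u" using left[of s] s by linarith+
    obtain e where e: "s < e" "p e \<noteq> Some x" "p e \<noteq> None" "\<And>u. s \<le> u \<Longrightarrow> u < e \<Longrightarrow> p u = Some x"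
      using next_exit[of s x] s by auto
    then have "t + \<delta> \<le> e" using noexit[of s e] \<open>t < s\<close> s \<delta> by auto
    then show ?thesis using e(4)[of u] \<open>s < u\<close> that by auto
  qed
  \<comment> \<open>Seen from \<open>q\<close>, the attained first hit of \<open>x\<close> comes
    after \<open>t\<close>, yet times arbitrarily close after \<open>t\<close> are already
    visits.\<close>
  obtain q where q: "q \<in> \<rat>" "t - \<delta> < q" "q < t" using Rats_dense_in_real[of "t - \<delta>" t] \<delta> by auto
  then obtain r where r: "r \<ge> 0" "p (r + q) = Some x" "\<And>u. 0 \<le> u \<Longrightarrow> u < r \<Longrightarrow> p (u + q) \<noteq> Some x"
    using hit[of q x] \<delta> by (auto simp: hits_avoiding_def)
  have "t < r + q" using left[of "r + q"] r q by (auto simp: not_le[symmetric])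
  define u where "u = (t + min (r + q) (t + \<delta>)) / 2"
  have "t < u" "u < t + \<delta>" "u < r + q" using \<open>t < r + q\<close> \<delta> by (auto simp: u_def min_def)
  then show False using rgt[of u] r(3)[of "u - q"] q by auto
qed

lemma no_visit:
  assumes "0 \<le> t" "p t = None" "finite A"
  shows "\<exists>\<delta>>0. \<forall>s\<ge>0. \<bar>s - t\<bar> < \<delta> \<longrightarrow> p s \<notin> Some ` A"
  using assms(3)
proof (induction A)
  case empty
  then show ?case by (auto intro: exI[of _ 1])
next
  case (insert x A)
  then obtain \<delta> where "\<delta> > 0" "\<forall>s\<ge>0. \<bar>s - t\<bar> < \<delta> \<longrightarrow> p s \<notin> Some ` A" by blast
  moreover obtain \<delta>' where "\<delta>' > 0" "\<forall>s\<ge>0. \<bar>s - t\<bar> < \<delta>' \<longrightarrow> p s \<noteq> Some x"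
    using no_visit_vertex[OF assms(1,2)] by blast
  ultimately show ?case by (intro exI[of _ "min \<delta> \<delta>'"]) auto
qed

lemma stays_in_component:
  assumes "0 \<le> t" "p t = None" "finite A"
  shows "\<exists>C\<in>components_off E A. \<exists>\<delta>>0. \<forall>s\<ge>0. \<bar>s - t\<bar> < \<delta> \<longrightarrow> p s \<in> Some ` C \<union> {None}"
proof -
  have "t > 0" using assms rat[of 0] by (cases "t = 0") auto
  obtain \<delta> where \<delta>: "\<delta> > 0" "\<And>s. 0 \<le> s \<Longrightarrow> \<bar>s - t\<bar> < \<delta> \<Longrightarrow> p s \<notin> Some ` A"
    using no_visit[OF assms] by blast
  \<comment> \<open>Reaching \<open>y\<close> outside \<open>K\<close> would require a visit to
    \<open>A\<close> no later than \<open>s\<close>, hence inside the window that avoids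
    \<open>A\<close>.\<close>
  have later: "y \<in> K"
    if q: "q \<in> \<rat>" "0 \<le> q" and "t - \<delta> < q" "q \<le> s" "s < t + \<delta>"
      and K: "K \<in> components_off E A" "x \<in> K" "p q = Some x" and "p s = Some y" for q s K x y
  proof (rule ccontr)
    assume "y \<notin> K"
    have "\<bar>s - t\<bar> < \<delta>" using that by (auto simp: abs_less_iff)
    then have "y \<notin> A" using \<delta>(2)[of s] that by auto
    then obtain r where r: "r \<ge> 0" "p (r + q) \<in> Some ` A"
        "\<And>u. 0 \<le> u \<Longrightarrow> u < r \<Longrightarrow> p (u + q) \<notin> Some ` insert y A"
      using cross[OF q assms(3) K(1,2) \<open>y \<notin> K\<close> _ K(3)] unfolding hits_avoiding_def by blast
    then have "r + q \<le> s" using r(3)[of "s - q"] that by (auto simp: not_less[symmetric])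
    then have "\<bar>r + q - t\<bar> < \<delta>" using that r by (auto simp: abs_less_iff)
    then show False using \<delta>(2)[of "r + q"] that r by auto
  qed
  obtain q where q: "q \<in> \<rat>" "max 0 (t - \<delta>) < q" "q < t"
    using Rats_dense_in_real[of "max 0 (t - \<delta>)" t] \<delta> \<open>t > 0\<close> by auto
  then obtain v where v: "p q = Some v" using rat[of q] by auto
  then have "v \<notin> A" using \<delta>(2)[of q] q by auto
  then obtain C where C: "C \<in> components_off E A" "v \<in> C" using components_off_cover by metis
  have "p s \<in> Some ` C \<union> {None}" if s: "0 \<le> s" "\<bar>s - t\<bar> < \<delta>" for s
  proof (cases "p s")
    case (Some y)
    show ?thesis
    proof (cases "q \<le> s")
      case True
      then show ?thesis using later[of q s C v y] q C v Some s by auto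
    next
      case False
      have "y \<notin> A" using \<delta>(2)[of s] s Some by auto
      then obtain K where K: "K \<in> components_off E A" "y \<in> K" using components_off_cover by metis
      obtain \<epsilon> where \<epsilon>: "\<epsilon> > 0" "\<And>u. u \<in> {s..s+\<epsilon>} \<Longrightarrow> p u = Some y"
        using right[OF s(1)] Some by force
      \<comment> \<open>\<open>cross\<close> runs only forward from rational times, so the stay at
        \<open>y\<close> supplies a rational start from which the trajectory reaches
        \<open>v\<close> at time \<open>q\<close>.\<close>
      obtain q' where q': "q' \<in> \<rat>" "s < q'" "q' < min (s + \<epsilon>) q"
        using Rats_dense_in_real[of s "min (s + \<epsilon>) q"] \<epsilon> False by auto
      then have "v \<in> K" using later[of q' q K y v] q v K s \<epsilon>(2)[of q'] \<delta> by auto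
      then have "K = C" using components_off_same K C by metis
      then show ?thesis using K Some by auto
    qed
  qed simp
  then show ?thesis using C \<delta> by blast
qed

text \<open>The condition over all exhaustions amounts to prescribing the component of the end for
  every nonempty finite set, because each such set begins some exhaustion;
  \<open>direction_end\<close> then applies.\<close>

lemma unique_end_at_infinity:
  assumes "countable (UNIV :: 'v set)" "connected_graph E" "locally_finite_graph E" "0 \<le> t" "p t = None"
  shows "\<exists>!\<xi>. \<xi> \<in> ends E \<and>
      (\<forall>W. finite_exhaustion W \<longrightarrow>
        (\<forall>n\<ge>1. \<exists>\<epsilon>>0. \<forall>s\<ge>0. t - \<epsilon> < s \<and> s < t + \<epsilon> \<longrightarrow>
           p s \<in> Some ` end_component E (W n) \<xi> \<union> {None}))"
    (is "\<exists>!\<xi>. \<xi> \<in> ends E \<and> ?near \<xi>")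
proof -
  define near where "near A K \<longleftrightarrow> (\<exists>\<epsilon>>0. \<forall>s\<ge>0. t - \<epsilon> < s \<and> s < t + \<epsilon> \<longrightarrow> p s \<in> Some ` K \<union> {None})"
    for A K :: "'v set"
  have "t > 0" using assms rat[of 0] by (cases "t = 0") auto
  \<comment> \<open>Near \<open>t\<close> there are rational times, at which the trajectory is at a
    vertex; that vertex lies in both sets and allows components chosen for different finite sets to
    be compared.\<close>
  have common: "\<exists>x. x \<in> K \<and> x \<in> K'" if K: "near A K" "near A' K'" for A A' K K'
  proof -
    from K obtain \<epsilon> \<epsilon>' where \<epsilon>: "\<epsilon> > 0" "\<epsilon>' > 0"
      "\<And>s. 0 \<le> s \<Longrightarrow> t - \<epsilon> < s \<Longrightarrow> s < t + \<epsilon> \<Longrightarrow> p s \<in> Some ` K \<union> {None}"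
      "\<And>s. 0 \<le> s \<Longrightarrow> t - \<epsilon>' < s \<Longrightarrow> s < t + \<epsilon>' \<Longrightarrow> p s \<in> Some ` K' \<union> {None}"
      unfolding near_def by metis
    obtain q where q: "q \<in> \<rat>" "max 0 (max (t - \<epsilon>) (t - \<epsilon>')) < q" "q < t"
      using Rats_dense_in_real[of "max 0 (max (t - \<epsilon>) (t - \<epsilon>'))" t] \<epsilon>(1,2) \<open>t > 0\<close> by auto
    then show ?thesis using \<epsilon>(3,4)[of q] rat[of q] \<epsilon>(1,2) by fastforce
  qed
  have "\<forall>A. \<exists>K. finite A \<longrightarrow> K \<in> components_off E A \<and> near A K"
    using stays_in_component[OF assms(4,5)] unfolding near_def abs_less_iff
    by (metis add.commute diff_less_eq less_diff_eq minus_diff_eq)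
  then obtain C where C: "\<And>A. finite A \<Longrightarrow> C A \<in> components_off E A" "\<And>A. finite A \<Longrightarrow> near A (C A)"
    by metis
  have mono: "C B \<subseteq> C A" if "finite B" "A \<subseteq> B" for A B
  proof -
    have "finite A" using that finite_subset by blast
    then show ?thesis
      using common[OF C(2) C(2), of A B] components_off_mono[OF that(2) C(1) C(1)] that by blast
  qed
  have iff: "?near \<xi> \<longleftrightarrow> (\<forall>A. finite A \<and> A \<noteq> {} \<longrightarrow> end_component E A \<xi> = C A)" if "\<xi> \<in> ends E" for \<xi>
  proof
    assume eq: "\<forall>A. finite A \<and> A \<noteq> {} \<longrightarrow> end_component E A \<xi> = C A"
    then show "?near \<xi>"
      using C(2) unfolding finite_exhaustion_def near_def by fastforce
  next
    assume near: "?near \<xi>"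
    show "\<forall>A. finite A \<and> A \<noteq> {} \<longrightarrow> end_component E A \<xi> = C A"
    proof (intro allI impI)
      fix A :: "'v set" assume A: "finite A \<and> A \<noteq> {}"
      \<comment> \<open>The shift in \<open>n - 1\<close> gives \<open>W 1 = A\<close>.\<close>
      define W where "W n = A \<union> from_nat_into UNIV ` {..<n - 1}" for n
      have "\<exists>n\<ge>1. x \<in> W n" for x
      proof -
        obtain k where "from_nat_into UNIV k = x" using from_nat_into_surj[OF assms(1), of x] by auto
        then have "x \<in> W (Suc (Suc k))" by (auto simp: W_def)
        then show ?thesis by (intro exI[of _ "Suc (Suc k)"]) simp
      qed
      then have "finite_exhaustion W"
        using A unfolding finite_exhaustion_def by (auto simp: W_def)
      then have "near A (end_component E (W 1) \<xi>)" using near unfolding near_def by blast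
      then have nearA: "near A (end_component E A \<xi>)" by (simp add: W_def)
      \<comment> \<open>A representative ray shows that the definite description denotes a genuine
        component, so one common vertex identifies it with \<open>C A\<close>.\<close>
      obtain Q where Q: "Q \<in> rays E" "\<xi> = ray_rel E `` {Q}"
        using \<open>\<xi> \<in> ends E\<close> by (auto simp: ends_def quotient_def)
      obtain K where K: "K \<in> components_off E A" "\<forall>\<^sub>F k in sequentially. Q k \<in> K"
        using ray_eventually_component[OF Q(1)] A by blast
      then have "end_component E A \<xi> = K" using end_component_eq[OF Q(1) _ K] A Q(2) by blast
      then show "end_component E A \<xi> = C A"
        using common[OF nearA C(2), of A] components_off_same[OF K(1) C(1)] A by auto
    qed
  qed
  show ?thesis
    using direction_end[OF assms(2,3) C(1) mono] iff by (simp cong: conj_cong)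
qed

end

section \<open>Almost sure properties of the walk\<close>

lemma before_exit:
  assumes "0 < u" "u < Inf (exit_times Y z \<omega>)"
  shows "Y u \<omega> = Some z"
proof (rule ccontr)
  assume "Y u \<omega> \<noteq> Some z"
  then have "Inf (exit_times Y z \<omega>) \<le> u"
    using assms(1) by (intro cInf_lower bdd_belowI[of _ 0]) (auto simp: exit_times_def)
  then show False using assms by simp
qed

lemma before_hit:
  assumes "0 \<le> u" "u < Inf (hit_times Y A \<omega>)"
  shows "Y u \<omega> \<notin> Some ` A"
proof
  assume "Y u \<omega> \<in> Some ` A"
  then have "Inf (hit_times Y A \<omega>) \<le> u"
    using assms(1) by (intro cInf_lower bdd_belowI[of _ 0]) (auto simp: hit_times_def)
  then show False using assms by simp
qed

locale walk_on_graph =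
  fixes E :: "'v set set" and c :: "'v set \<Rightarrow> real" and w :: "'v \<Rightarrow> real"
    and M :: "'v \<Rightarrow> 'w measure" and X :: "'v \<Rightarrow> real \<Rightarrow> 'w \<Rightarrow> 'v option"
  assumes walk: "reflected_walk E c w M X"
    and graph: "conductance_graph E c" "connected_graph E" "locally_finite_graph E"
    and verts: "countable (UNIV :: 'v set)" "infinite (UNIV :: 'v set)"
    and rate_pos: "0 < w x"
begin

section \<open>The Markov property as a transfer of almost sure path properties\<close>

lemma prob_M: "prob_space (M z)"
  using walk by (simp add: reflected_walk_def)

lemma prob_completion: "prob_space (completion (M z))"
  using prob_space.prob_space_completion[OF prob_M] .

lemma X_measurable: "0 \<le> t \<Longrightarrow> X z t \<in> measurable (M z) (count_space UNIV)"
  using walk by (simp add: reflected_walk_def)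

lemma state_event: "0 \<le> t \<Longrightarrow> {\<omega>\<in>space (M z). X z t \<omega> = y} \<in> sets (M z)"
  using measurable_sets[OF X_measurable, of t "{y}" z] by (simp add: vimage_def Int_def conj_commute)

lemma subalgebra_past: "subalgebra (completion (M z)) (past (M z) (X z) t)"
proof -
  have "(\<lambda>\<omega>. \<lambda>s\<in>{0..t}. X z s \<omega>) \<in> measurable (M z) (\<Pi>\<^sub>M s\<in>{0..t}. count_space UNIV)"
    by (intro measurable_restrict X_measurable) auto
  then have "sets (past (M z) (X z) t) \<subseteq> sets (M z)"
    unfolding past_def by (intro sets_image_in_sets) auto
  then show ?thesis by (auto simp: subalgebra_def past_def)
qed

lemma state_event_past:
  assumes "0 \<le> t"
  shows "{\<omega>\<in>space (M z). X z t \<omega> = y} \<in> sets (past (M z) (X z) t)"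
proof -
  let ?P = "\<Pi>\<^sub>M s\<in>{0..t}. count_space (UNIV :: 'v option set)"
  have "(\<lambda>f. f t) \<in> measurable ?P (count_space UNIV)"
    using assms by (intro measurable_component_singleton) auto
  then have "(\<lambda>f. f t) -` {y} \<inter> space ?P \<in> sets ?P" by (rule measurable_sets) simp
  note in_vimage_algebra[OF this, of "\<lambda>\<omega>. \<lambda>s\<in>{0..t}. X z s \<omega>" "space (M z)"]
  moreover have "(\<lambda>\<omega>. \<lambda>s\<in>{0..t}. X z s \<omega>) -` ((\<lambda>f. f t) -` {y} \<inter> space ?P) \<inter> space (M z)
      = {\<omega>\<in>space (M z). X z t \<omega> = y}"
    using assms by (auto simp: space_PiM)
  ultimately show ?thesis by (simp add: past_def)
qed

text \<open>The event that the state at \<open>t\<close> is \<open>x\<close> belongs to the past, so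
  integrating the conditional expectation over it gives back the probability of
  \<open>S\<close>.\<close>

lemma markov_event:
  fixes z x :: 'v
  assumes "0 \<le> t" and B: "{\<omega>\<in>space (M x). path (X x) \<omega> \<in> B} \<in> sets (completion (M x))"
  defines "S \<equiv> {\<omega>\<in>space (M z). X z t \<omega> = Some x \<and> path (\<lambda>s. X z (s + t)) \<omega> \<in> B}"
  shows "S \<in> sets (completion (M z))"
    and "measure (completion (M z)) S = measure (M z) {\<omega>\<in>space (M z). X z t \<omega> = Some x}
      * measure (completion (M x)) {\<omega>\<in>space (M x). path (X x) \<omega> \<in> B}"
proof -
  let ?M = "completion (M z)" and ?F = "{\<omega>\<in>space (M z). X z t \<omega> = Some x}"
  let ?m = "measure (completion (M x)) {\<omega>\<in>space (M x). path (X x) \<omega> \<in> B}"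
  let ?P = "past (M z) (X z) t"
  interpret prob_space ?M by (rule prob_completion)
  interpret finite_measure_subalgebra ?M ?P
    by unfold_locales (rule subalgebra_past)
  have "markov_family M X" using walk by (simp add: reflected_walk_def)
  from this[unfolded markov_family_def Let_def, rule_format, OF assms(1) B, of z]
  have mk: "S \<in> sets ?M \<and> (AE \<omega> in M z. X z t \<omega> = Some x \<longrightarrow> real_cond_exp ?M ?P (indicator S) \<omega> = ?m)"
    unfolding S_def .
  then show S: "S \<in> sets ?M" by simp
  have F: "?F \<in> sets ?P" "?F \<in> sets (M z)"
    using state_event_past[OF assms(1)] state_event[OF assms(1)] by auto
  have ae: "AE \<omega> in ?M. X z t \<omega> = Some x \<longrightarrow> real_cond_exp ?M ?P (indicator S) \<omega> = ?m"
    using mk by (simp add: AE_completion)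
  have "measure ?M S = (\<integral>\<omega>. indicator S \<omega> \<partial>?M)"
    using S sets.sets_into_space[OF S] by (simp add: Int_absorb2)
  also have "\<dots> = (\<integral>\<omega>\<in>?F. indicator S \<omega> \<partial>?M)"
    unfolding set_lebesgue_integral_def by (intro Bochner_Integration.integral_cong) (auto simp: S_def indicator_def)
  also have "\<dots> = (\<integral>\<omega>\<in>?F. real_cond_exp ?M ?P (indicator S) \<omega> \<partial>?M)"
    using F S by (intro real_cond_exp_intA) (auto intro!: integrable_real_indicator simp: emeasure_eq_measure simp del: emeasure_completion)
  also have "\<dots> = (\<integral>\<omega>. indicator ?F \<omega> * ?m \<partial>?M)"
    unfolding set_lebesgue_integral_def real_scaleR_def
  proof (intro integral_cong_AE borel_measurable_times borel_measurable_indicator borel_measurable_const)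
    show "AE \<omega> in ?M. indicator ?F \<omega> * real_cond_exp ?M ?P (indicator S) \<omega> = indicator ?F \<omega> * ?m"
      using ae by eventually_elim (auto simp: indicator_def)
  qed (use F in auto)
  also have "\<dots> = measure ?M ?F * ?m" using F(2) by simp
  also have "measure ?M ?F = measure (M z) ?F" using F(2) by simp
  finally show "measure ?M S = measure (M z) ?F * ?m" .
qed

text \<open>\<open>\<Phi>\<close> need not be an event of the product sigma-algebra: its failure set
  is null, hence measurable in the completion, and \<open>markov_family\<close> covers all such path
  sets. \<open>restr\<close> says that only times in \<open>{0..}\<close> count, so passing to
  \<open>path\<close> loses nothing.\<close>

lemma markov_AE:
  assumes "0 \<le> t" and ae: "AE \<omega> in M x. \<Phi> (\<lambda>s. X x s \<omega>)"
    and restr: "\<And>p. \<Phi> (restrict p {0..}) \<longleftrightarrow> \<Phi> p"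
  shows "AE \<omega> in M z. X z t \<omega> = Some x \<longrightarrow> \<Phi> (\<lambda>s. X z (s + t) \<omega>)"
proof -
  let ?B = "Collect \<Phi>" and ?M = "completion (M z)" and ?N = "completion (M x)"
  let ?F = "{\<omega>\<in>space (M z). X z t \<omega> = Some x}"
  let ?S = "{\<omega>\<in>space (M z). X z t \<omega> = Some x \<and> path (\<lambda>s. X z (s + t)) \<omega> \<in> ?B}"
  interpret M: prob_space ?M by (rule prob_completion)
  interpret N: prob_space ?N by (rule prob_completion)
  have path: "path Y \<omega> \<in> ?B \<longleftrightarrow> \<Phi> (\<lambda>s. Y s \<omega>)" for Y :: "real \<Rightarrow> 'w \<Rightarrow> 'v option" and \<omega>
    unfolding path_def mem_Collect_eq by (rule restr)
  have ae': "AE \<omega> in M x. path (X x) \<omega> \<in> ?B" using ae by (simp only: path)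
  then have "AE \<omega> in M x. \<not> path (X x) \<omega> \<notin> ?B" by simp
  then have "Measurable.pred ?N (\<lambda>\<omega>. path (X x) \<omega> \<notin> ?B)" by (rule sets_completion_AE)
  then have "space ?N - {\<omega>\<in>space ?N. path (X x) \<omega> \<notin> ?B} \<in> sets ?N" by (auto simp: pred_def)
  moreover have "space ?N - {\<omega>\<in>space ?N. path (X x) \<omega> \<notin> ?B} = {\<omega>\<in>space (M x). path (X x) \<omega> \<in> ?B}"
    by auto
  ultimately have B: "{\<omega>\<in>space (M x). path (X x) \<omega> \<in> ?B} \<in> sets ?N" by simp
  have "measure ?N {\<omega>\<in>space (M x). path (X x) \<omega> \<in> ?B} = 1"
    using B AE_completion[OF ae'] N.prob_Collect_eq_1[of "\<lambda>\<omega>. path (X x) \<omega> \<in> ?B"] by simp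
  then have "measure ?M ?S = measure (M z) ?F"
    using markov_event(2)[OF assms(1) B, of z] by simp
  also have "\<dots> = measure ?M ?F" using state_event[OF assms(1)] by simp
  finally have "measure ?M (?F - ?S) = 0"
    using markov_event(1)[OF assms(1) B, of z] state_event[OF assms(1), of z "Some x"]
    by (subst M.finite_measure_Diff) auto
  then have "AE \<omega> in ?M. \<omega> \<notin> ?F - ?S"
    using markov_event(1)[OF assms(1) B, of z] state_event[OF assms(1), of z "Some x"]
    by (subst M.prob_eq_0[symmetric]) auto
  then have "AE \<omega> in M z. \<omega> \<notin> ?F - ?S" by (simp add: AE_completion_iff)
  then show ?thesis using AE_space
  proof eventually_elim
    case (elim \<omega>)
    then show ?case using path[of "\<lambda>s. X z (s + t)" \<omega>] by blast
  qed
qed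

lemma markov_AE_rat:
  assumes "\<And>x. Q x \<Longrightarrow> AE \<omega> in M x. \<Phi> x (\<lambda>s. X x s \<omega>)"
    and "\<And>x p. \<Phi> x (restrict p {0..}) \<longleftrightarrow> \<Phi> x p"
  shows "AE \<omega> in M z. \<forall>q\<in>\<rat> \<inter> {0..}. \<forall>x. Q x \<longrightarrow> X z q \<omega> = Some x \<longrightarrow> \<Phi> x (\<lambda>s. X z (s + q) \<omega>)"
proof -
  have "AE \<omega> in M z. \<forall>x. Q x \<longrightarrow> X z q \<omega> = Some x \<longrightarrow> \<Phi> x (\<lambda>s. X z (s + q) \<omega>)" if "q \<ge> 0" for q
  proof -
    have "AE \<omega> in M z. Q x \<longrightarrow> X z q \<omega> = Some x \<longrightarrow> \<Phi> x (\<lambda>s. X z (s + q) \<omega>)" for x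
      using markov_AE[OF that assms(1) assms(2)] by (cases "Q x") auto
    then have "AE \<omega> in M z. \<forall>x\<in>UNIV. Q x \<longrightarrow> X z q \<omega> = Some x \<longrightarrow> \<Phi> x (\<lambda>s. X z (s + q) \<omega>)"
      by (subst AE_ball_countable[OF verts(1)]) auto
    then show ?thesis by simp
  qed
  then show ?thesis by (subst AE_ball_countable) (auto intro: countable_Int1 countable_rat)
qed

section \<open>Exits and hits from a fixed starting vertex\<close>

lemma nbrs_nonempty: "nbrs E x \<noteq> {}"
proof -
  obtain y where "y \<noteq> x" using ex_new_if_finite[OF verts(2), of "{x}"] by auto
  moreover have "(x, y) \<in> (adj_off E {})\<^sup>*" using graph(2) by (simp add: connected_graph_def)
  ultimately obtain v where "(x, v) \<in> adj_off E {}" by (metis converse_rtranclE)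
  then show ?thesis by (auto simp: adj_off_def nbrs_def)
qed

lemma vertex_weight_pos: "0 < vertex_weight E c x"
  unfolding vertex_weight_def using nbrs_nonempty graph
  by (intro sum_pos) (auto simp: locally_finite_graph_def nbrs_def conductance_graph_edgeD)

text \<open>The jump probabilities to the finitely many neighbours add up to 1, so almost surely the
  exit does not lead to infinity.\<close>

lemma AE_exits_to_vertex: "AE \<omega> in M x. exits_to_vertex x (\<lambda>s. X x s \<omega>)"
proof -
  let ?M = "completion (M x)"
  interpret prob_space ?M by (rule prob_completion)
  define \<tau> where "\<tau> \<omega> = Inf (exit_times (X x) x \<omega>)" for \<omega>
  define J where "J \<omega> = X x (\<tau> \<omega>) \<omega>" for \<omega>
  have "first_jump_law E c w x (M x) (X x)" using walk by (simp add: reflected_walk_def)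
  then have \<tau>: "AE \<omega> in M x. \<tau> \<omega> \<in> exit_times (X x) x \<omega>"
    and J: "J \<in> measurable ?M (count_space UNIV)"
    and jump: "\<And>y. y \<in> nbrs E x \<Longrightarrow>
      prob {\<omega>\<in>space (M x). J \<omega> = Some y} = c {x, y} / vertex_weight E c x"
    unfolding first_jump_law_def Let_def J_def \<tau>_def by blast+
  have ev: "{\<omega>\<in>space (M x). J \<omega> = Some y} \<in> sets ?M" for y
    using measurable_sets[OF J, of "{Some y}"] by (simp add: vimage_def Int_def conj_commute)
  have "prob (\<Union>y\<in>nbrs E x. {\<omega>\<in>space (M x). J \<omega> = Some y})
      = (\<Sum>y\<in>nbrs E x. prob {\<omega>\<in>space (M x). J \<omega> = Some y})"
    using graph(3) ev
    by (intro finite_measure_finite_Union) (auto simp: locally_finite_graph_def disjoint_family_on_def)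
  also have "\<dots> = vertex_weight E c x / vertex_weight E c x"
    unfolding vertex_weight_def[of E c x] sum_divide_distrib
    by (intro sum.cong) (auto simp: jump vertex_weight_def)
  also have "\<dots> = 1" using vertex_weight_pos[of x] by simp
  finally have "AE \<omega> in ?M. \<omega> \<in> (\<Union>y\<in>nbrs E x. {\<omega>\<in>space (M x). J \<omega> = Some y})"
    by (rule AE_prob_1)
  then have "AE \<omega> in M x. J \<omega> \<noteq> None" unfolding AE_completion_iff by eventually_elim auto
  with \<tau> show ?thesis
  proof eventually_elim
    case (elim \<omega>)
    then have "0 < \<tau> \<omega>" "X x (\<tau> \<omega>) \<omega> \<noteq> Some x" "X x (\<tau> \<omega>) \<omega> \<noteq> None"
      by (simp_all add: exit_times_def J_def)
    moreover have "X x u \<omega> = Some x" if "0 < u" "u < \<tau> \<omega>" for u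
      using that unfolding \<tau>_def by (rule before_exit)
    ultimately show ?case unfolding exits_to_vertex_def by blast
  qed
qed

lemma AE_hit:
  assumes "finite A" "A \<noteq> {}"
  shows "AE \<omega> in M z. Inf (hit_times (X z) A \<omega>) \<in> hit_times (X z) A \<omega>"
    and "(\<lambda>\<omega>. X z (Inf (hit_times (X z) A \<omega>)) \<omega>) \<in> measurable (completion (M z)) (count_space UNIV)"
    and "energy_min_extension E c A \<phi> z
      = (LINT \<omega>|completion (M z). \<phi> (the (X z (Inf (hit_times (X z) A \<omega>)) \<omega>)))"
  using walk assms unfolding reflected_walk_def Let_def by blast+

lemma AE_hits:
  assumes "finite A" "A \<noteq> {}"
  shows "AE \<omega> in M z. hits_avoiding A A (\<lambda>s. X z s \<omega>)"
  using AE_hit(1)[OF assms, of z]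
proof eventually_elim
  case (elim \<omega>)
  then have "0 \<le> Inf (hit_times (X z) A \<omega>)" "X z (Inf (hit_times (X z) A \<omega>)) \<omega> \<in> Some ` A"
    by (simp_all add: hit_times_def)
  then show ?case unfolding hits_avoiding_def using before_hit[of _ "X z" A \<omega>] by blast
qed

text \<open>For the indicator of \<open>y\<close> as boundary function on \<open>insert y A\<close>,
  the minimizer at \<open>x\<close> is the probability of hitting \<open>y\<close> first, and it is
  0 because \<open>y\<close> lies outside the component of \<open>x\<close>.\<close>

lemma AE_no_cross:
  assumes "finite A" "C \<in> components_off E A" "x \<in> C" "y \<notin> C" "y \<notin> A"
  shows "AE \<omega> in M x. hits_avoiding A (insert y A) (\<lambda>s. X x s \<omega>)"
proof -
  let ?M = "completion (M x)"
  interpret prob_space ?M by (rule prob_completion)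
  define \<tau> where "\<tau> \<omega> = Inf (hit_times (X x) (insert y A) \<omega>)" for \<omega>
  define \<phi> where "\<phi> = (indicator {y} :: 'v \<Rightarrow> real)"
  have fin: "finite (insert y A)" "insert y A \<noteq> {}" using assms by auto
  have meas: "(\<lambda>\<omega>. X x (\<tau> \<omega>) \<omega>) \<in> measurable ?M (count_space UNIV)"
    unfolding \<tau>_def by (rule AE_hit(2)[OF fin])
  have \<phi>_meas: "(\<lambda>\<omega>. \<phi> (the (X x (\<tau> \<omega>) \<omega>))) \<in> borel_measurable ?M"
    using measurable_compose[OF meas, of "\<lambda>s. \<phi> (the s)" borel] by simp
  have int: "integrable ?M (\<lambda>\<omega>. \<phi> (the (X x (\<tau> \<omega>) \<omega>)))"
    by (rule integrable_const_bound[of _ 1]) (use \<phi>_meas in \<open>auto simp: \<phi>_def\<close>)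
  have "energy_min_extension E c (A \<union> {y}) \<phi> x = 0"
    using assms graph by (intro energy_min_extension_eq_0[where C = C]) (auto simp: \<phi>_def indicator_def)
  then have "(LINT \<omega>|?M. \<phi> (the (X x (\<tau> \<omega>) \<omega>))) = 0"
    using AE_hit(3)[OF fin, of \<phi> x] by (simp add: \<tau>_def)
  moreover have "AE \<omega> in ?M. 0 \<le> \<phi> (the (X x (\<tau> \<omega>) \<omega>))" by (simp add: \<phi>_def)
  ultimately have "AE \<omega> in ?M. \<phi> (the (X x (\<tau> \<omega>) \<omega>)) = 0"
    using integral_nonneg_eq_0_iff_AE[OF int] by blast
  then have "AE \<omega> in M x. X x (\<tau> \<omega>) \<omega> \<noteq> Some y"
    unfolding AE_completion_iff by eventually_elim (auto simp: \<phi>_def)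
  with AE_hit(1)[OF fin, of x] show ?thesis
  proof eventually_elim
    case (elim \<omega>)
    then have "\<tau> \<omega> \<in> hit_times (X x) (insert y A) \<omega>" by (simp add: \<tau>_def)
    then have "0 \<le> \<tau> \<omega>" "X x (\<tau> \<omega>) \<omega> \<in> Some ` A"
      using elim(2) by (auto simp: hit_times_def)
    moreover have "X x u \<omega> \<notin> Some ` insert y A" if "0 \<le> u" "u < \<tau> \<omega>" for u
      using that unfolding \<tau>_def by (rule before_hit)
    ultimately show ?case unfolding hits_avoiding_def by blast
  qed
qed

section \<open>Finitely many exits in bounded time\<close>

definition short_stay :: "'v \<Rightarrow> 'v \<Rightarrow> real \<Rightarrow> real \<Rightarrow> 'w set" where
  "short_stay z x t \<delta> = {\<omega>\<in>space (M z). X z t \<omega> = Some x \<and>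
     Inf {s. 0 < s \<and> X z (s + t) \<omega> \<noteq> Some x} \<le> \<delta>}"

text \<open>Given state \<open>x\<close> at time \<open>t\<close>, the remaining stay is exponential
  with rate \<open>w x\<close> by the Markov property, and
  \<open>1 - exp (- \<delta> * w x) \<le> w x * \<delta>\<close>.\<close>

lemma short_stay:
  assumes "0 \<le> t" "0 \<le> \<delta>"
  shows "short_stay z x t \<delta> \<in> sets (completion (M z))"
    and "measure (completion (M z)) (short_stay z x t \<delta>) \<le> w x * \<delta>"
proof -
  let ?M = "completion (M z)" and ?N = "completion (M x)"
  interpret N: prob_space ?N by (rule prob_completion)
  interpret M: prob_space "M z" by (rule prob_M)
  define B where "B = {p :: real \<Rightarrow> 'v option. Inf {s. 0 < s \<and> p s \<noteq> Some x} \<le> \<delta>}"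
  let ?\<tau> = "\<lambda>\<omega>. Inf (exit_times (X x) x \<omega>)"
  have pathB: "path Y \<omega> \<in> B \<longleftrightarrow> Inf {s. 0 < s \<and> Y s \<omega> \<noteq> Some x} \<le> \<delta>"
    for Y :: "real \<Rightarrow> 'w \<Rightarrow> 'v option" and \<omega>
  proof -
    have "{s. 0 < s \<and> path Y \<omega> s \<noteq> Some x} = {s. 0 < s \<and> Y s \<omega> \<noteq> Some x}"
      by (auto simp: path_def)
    then show ?thesis by (simp add: B_def)
  qed
  have "first_jump_law E c w x (M x) (X x)" using walk by (simp add: reflected_walk_def)
  then have D: "distributed ?N lborel ?\<tau> (exponential_density (w x))"
    by (simp add: first_jump_law_def Let_def)
  then have \<tau>: "?\<tau> \<in> borel_measurable ?N" by (simp add: distributed_def)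
  have eq: "{\<omega>\<in>space (M x). path (X x) \<omega> \<in> B} = {\<omega>\<in>space ?N. ?\<tau> \<omega> \<le> \<delta>}"
    by (simp add: pathB exit_times_def)
  have ev: "{\<omega>\<in>space (M x). path (X x) \<omega> \<in> B} \<in> sets ?N"
    unfolding eq using \<tau> by (intro borel_measurable_le) auto
  have "measure ?N {\<omega>\<in>space (M x). path (X x) \<omega> \<in> B} = 1 - exp (- \<delta> * w x)"
    unfolding eq using N.exponential_distributedD_le[OF D assms(2) rate_pos] by simp
  also have "\<dots> \<le> w x * \<delta>" using exp_ge_add_one_self[of "- \<delta> * w x"] by (simp add: mult.commute)
  finally have le: "measure ?N {\<omega>\<in>space (M x). path (X x) \<omega> \<in> B} \<le> w x * \<delta>" .
  have S: "short_stay z x t \<delta> =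
      {\<omega>\<in>space (M z). X z t \<omega> = Some x \<and> path (\<lambda>s. X z (s + t)) \<omega> \<in> B}"
    unfolding short_stay_def pathB by simp
  show "short_stay z x t \<delta> \<in> sets ?M" unfolding S by (rule markov_event(1)[OF assms(1) ev])
  have "measure ?M (short_stay z x t \<delta>) \<le> 1 * (w x * \<delta>)"
    unfolding S markov_event(2)[OF assms(1) ev] using le
    by (intro mult_mono) auto
  then show "measure ?M (short_stay z x t \<delta>) \<le> w x * \<delta>" by simp
qed

text \<open>Every exit from \<open>x\<close> that ends a stay longer than \<open>2^-n\<close> is counted by the last point of the
  dyadic grid before it.  The expected count over \<open>[0, T]\<close> is at most \<open>w x * T\<close> for all \<open>n\<close>, so by
  Fatou's lemma its lower limit is almost surely finite.\<close>

definition grid_exits :: "'v \<Rightarrow> 'v \<Rightarrow> nat \<Rightarrow> 'w \<Rightarrow> nat \<Rightarrow> nat set" where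
  "grid_exits z x T \<omega> n = {k. k < T * 2 ^ n \<and> \<omega> \<in> short_stay z x (k / 2 ^ n) (1 / 2 ^ n)}"

text \<open>Once the mesh is finer than the stays preceding the exits in \<open>G\<close>, every
  exit has a grid point inside its own stay, and distinct exits have distinct grid points.\<close>

lemma card_exits_le_grid:
  assumes \<omega>: "\<omega> \<in> space (M z)" and G: "finite G" "G \<subseteq> exits_before (real T) x (\<lambda>s. X z s \<omega>)"
  shows "\<forall>\<^sub>F n in sequentially. card G \<le> card (grid_exits z x T \<omega> n)"
proof -
  have "\<forall>e\<in>G. \<exists>s\<ge>0. s < e \<and> (\<forall>u\<in>{s..<e}. X z u \<omega> = Some x)"
    using G(2) by (auto simp: exits_before_def)
  then obtain a where a: "\<And>e. e \<in> G \<Longrightarrow> 0 \<le> a e" "\<And>e. e \<in> G \<Longrightarrow> a e < e"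
    "\<And>e u. e \<in> G \<Longrightarrow> a e \<le> u \<Longrightarrow> u < e \<Longrightarrow> X z u \<omega> = Some x"
    by (metis atLeastLessThan_iff)
  have Ge: "0 < e" "e \<le> T" "X z e \<omega> \<noteq> Some x" if "e \<in> G" for e
    using that G(2) by (auto simp: exits_before_def)
  have "\<forall>\<^sub>F n in sequentially. 1 / 2 ^ n < e - a e" if "e \<in> G" for e
  proof -
    have "(\<lambda>n. (1 / 2) ^ n :: real) \<longlonglongrightarrow> 0" by (rule LIMSEQ_power_zero) simp
    from order_tendstoD(2)[OF this, of "e - a e"] a(2)[OF that] show ?thesis
      by (simp add: power_one_over)
  qed
  then have "\<forall>\<^sub>F n in sequentially. \<forall>e\<in>G. 1 / 2 ^ n < e - a e"
    using G(1) by (simp add: eventually_ball_finite)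
  then show ?thesis
  proof eventually_elim
    case (elim n)
    \<comment> \<open>Ceiling minus one selects the last grid point strictly before
      \<open>e\<close>, even when \<open>e\<close> is itself a grid point.\<close>
    define k where "k e = nat (\<lceil>e * 2 ^ n\<rceil> - 1)" for e :: real
    have k: "real (k e) / 2 ^ n < e" "e \<le> real (k e) / 2 ^ n + 1 / 2 ^ n" if "e \<in> G" for e
    proof -
      have "0 < e * 2 ^ n" using Ge(1)[OF that] by simp
      then have "real (k e) = of_int \<lceil>e * 2 ^ n\<rceil> - 1" by (simp add: k_def)
      then have "real (k e) < e * 2 ^ n" "e * 2 ^ n \<le> real (k e) + 1" by linarith+
      then show "real (k e) / 2 ^ n < e" "e \<le> real (k e) / 2 ^ n + 1 / 2 ^ n"
        by (simp_all add: field_simps)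
    qed
    have ak: "a e < real (k e) / 2 ^ n" if "e \<in> G" for e
      using k(2)[OF that] elim that by force
    have "k e \<in> grid_exits z x T \<omega> n" if e: "e \<in> G" for e
    proof -
      let ?t = "real (k e) / 2 ^ n"
      have "real (k e) < real T * 2 ^ n"
        using k(1)[OF e] Ge(2)[OF e] by (simp add: pos_divide_less_eq) (meson less_le_trans mult_right_mono zero_le_numeral zero_le_power)
      then have "real (k e) < real (T * 2 ^ n)" by simp
      then have "k e < T * 2 ^ n" by (simp only: of_nat_less_iff)
      moreover have "X z ?t \<omega> = Some x" using a(3)[OF e, of ?t] ak[OF e] k(1)[OF e] by simp
      moreover have "Inf {s. 0 < s \<and> X z (s + ?t) \<omega> \<noteq> Some x} \<le> e - ?t"
        using Ge(3)[OF e] k(1)[OF e] by (intro cInf_lower bdd_belowI[of _ 0]) auto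
      ultimately show ?thesis
        using \<omega> k(2)[OF e] by (simp add: grid_exits_def short_stay_def)
    qed
    moreover have "inj_on k G"
    proof (rule inj_onI)
      \<comment> \<open>If a later exit \<open>e'\<close> shared the grid point of \<open>e\<close>,
        its stay would start before that point and cover \<open>e\<close>, where the state is not
        \<open>x\<close>.\<close>
      have *: "e' \<le> e" if "e \<in> G" "e' \<in> G" "k e = k e'" for e e'
      proof (rule ccontr)
        assume "\<not> e' \<le> e"
        then have "X z e \<omega> = Some x" using a(3)[OF that(2), of e] ak[OF that(2)] k(1)[OF that(1)] that(3) by simp
        then show False using Ge(3)[OF that(1)] by simp
      qed
      show "e = e'" if "e \<in> G" "e' \<in> G" "k e = k e'" for e e'
        using *[of e e'] *[of e' e] that by simp
    qed
    moreover have "finite (grid_exits z x T \<omega> n)" by (simp add: grid_exits_def)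
    ultimately show ?case by (metis card_inj_on_le image_subsetI)
  qed
qed

lemma AE_finite_exits: "AE \<omega> in M z. finite (exits_before (real T) x (\<lambda>s. X z s \<omega>))"
proof -
  let ?M = "completion (M z)"
  interpret prob_space ?M by (rule prob_completion)
  define N :: "nat \<Rightarrow> 'w \<Rightarrow> ennreal" where
    "N n \<omega> = (\<Sum>k<T * 2 ^ n. indicator (short_stay z x (k / 2 ^ n) (1 / 2 ^ n)) \<omega>)" for n \<omega>
  have N_card: "N n \<omega> = of_nat (card (grid_exits z x T \<omega> n))" for n \<omega>
    unfolding N_def indicator_def grid_exits_def
    by (simp add: sum.If_cases Int_def lessThan_def)
  have ev: "short_stay z x (k / 2 ^ n) (1 / 2 ^ n) \<in> sets ?M" for k n :: nat
    by (rule short_stay) auto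
  have N_meas: "N n \<in> borel_measurable ?M" for n
    unfolding N_def using ev by (intro borel_measurable_sum borel_measurable_indicator)
  have N_le: "(\<integral>\<^sup>+\<omega>. N n \<omega> \<partial>?M) \<le> ennreal (w x * T)" for n
  proof -
    have "(\<integral>\<^sup>+\<omega>. N n \<omega> \<partial>?M) = (\<Sum>k<T * 2 ^ n. emeasure ?M (short_stay z x (k / 2 ^ n) (1 / 2 ^ n)))"
      unfolding N_def using ev by (subst nn_integral_sum) (auto intro: borel_measurable_indicator)
    also have "\<dots> \<le> (\<Sum>k<T * 2 ^ n. ennreal (w x * (1 / 2 ^ n)))"
      unfolding emeasure_eq_measure by (intro sum_mono ennreal_leI short_stay) auto
    also have "\<dots> = ennreal (w x * T)"
      using rate_pos[of x] by (subst sum_ennreal) auto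
    finally show ?thesis .
  qed
  have "(\<integral>\<^sup>+\<omega>. liminf (\<lambda>n. N n \<omega>) \<partial>?M) \<le> liminf (\<lambda>n. \<integral>\<^sup>+\<omega>. N n \<omega> \<partial>?M)"
    by (rule nn_integral_liminf[OF N_meas])
  also have "\<dots> \<le> liminf (\<lambda>n. ennreal (w x * T))" by (intro Liminf_mono always_eventually allI N_le)
  also have "\<dots> < \<infinity>" by (simp add: Liminf_const)
  finally have "AE \<omega> in ?M. liminf (\<lambda>n. N n \<omega>) \<noteq> \<infinity>"
    using N_meas by (intro nn_integral_PInf_AE) auto
  then have "AE \<omega> in M z. liminf (\<lambda>n. N n \<omega>) \<noteq> \<infinity>" by (simp add: AE_completion_iff)
  then show ?thesis using AE_space
  proof eventually_elim
    case (elim \<omega>)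
    then obtain K :: nat where "liminf (\<lambda>n. N n \<omega>) < of_nat K"
      using ennreal_Ex_less_of_nat[of "liminf (\<lambda>n. N n \<omega>)"] by (auto simp: less_top)
    then have "\<not> (\<forall>\<^sub>F n in sequentially. of_nat K \<le> N n \<omega>)"
      using Liminf_bounded[of "of_nat K" "\<lambda>n. N n \<omega>" sequentially] by auto
    then have freq: "\<exists>\<^sub>F n in sequentially. card (grid_exits z x T \<omega> n) < K"
      unfolding frequently_def N_card by (simp add: not_less)
    \<comment> \<open>The grid level \<open>n\<close> depends on \<open>G\<close> but
      \<open>K\<close> does not, and a uniform bound on finite subsets forces finiteness.\<close>
    have "card G \<le> K" if G: "G \<subseteq> exits_before (real T) x (\<lambda>s. X z s \<omega>)" "finite G" for G
    proof -
      obtain n where "card G \<le> card (grid_exits z x T \<omega> n)" "card (grid_exits z x T \<omega> n) < K"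
        using frequently_ex[OF frequently_eventually_conj[OF freq card_exits_le_grid[OF elim(2) G(2,1)]]]
        by blast
      then show ?thesis by simp
    qed
    then show ?case using finite_if_finite_subsets_card_bdd by blast
  qed
qed

lemma AE_good_trajectory: "AE \<omega> in M z. good_trajectory E (\<lambda>s. X z s \<omega>)"
proof -
  have 1: "AE \<omega> in M z. \<forall>q\<in>\<rat> \<inter> {0..}. X z q \<omega> \<noteq> None"
    using walk unfolding reflected_walk_def
    by (subst AE_ball_countable) (auto intro: countable_Int1 countable_rat)
  have 2: "AE \<omega> in M z. \<forall>t\<ge>0. X z t \<omega> \<noteq> None \<longrightarrow> (\<exists>\<epsilon>>0. \<forall>s\<in>{t..t+\<epsilon>}. X z s \<omega> = X z t \<omega>)"
    using walk unfolding reflected_walk_def by blast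
  have 3: "AE \<omega> in M z. \<forall>q\<in>\<rat> \<inter> {0..}. \<forall>x. True \<longrightarrow> X z q \<omega> = Some x \<longrightarrow>
      exits_to_vertex x (\<lambda>s. X z (s + q) \<omega>)"
    by (intro markov_AE_rat AE_exits_to_vertex exits_to_vertex_restrict)
  have "AE \<omega> in M z. \<forall>q\<in>\<rat> \<inter> {0..}. \<forall>x. True \<longrightarrow> X z q \<omega> = Some x \<longrightarrow>
      hits_avoiding {y} {y} (\<lambda>s. X z (s + q) \<omega>)" for y
    by (intro markov_AE_rat AE_hits hits_avoiding_restrict) auto
  then have 4: "AE \<omega> in M z. \<forall>y\<in>UNIV. \<forall>q\<in>\<rat> \<inter> {0..}. \<forall>x. True \<longrightarrow> X z q \<omega> = Some x \<longrightarrow>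
      hits_avoiding {y} {y} (\<lambda>s. X z (s + q) \<omega>)"
    by (subst AE_ball_countable[OF verts(1)]) auto
  have "AE \<omega> in M z. \<forall>q\<in>\<rat> \<inter> {0..}. \<forall>x. (\<exists>C\<in>components_off E A. x \<in> C \<and> y \<notin> C) \<longrightarrow>
      X z q \<omega> = Some x \<longrightarrow> hits_avoiding A (insert y A) (\<lambda>s. X z (s + q) \<omega>)"
    if "finite A" "y \<notin> A" for A y
    by (rule markov_AE_rat) (use AE_no_cross that in blast, rule hits_avoiding_restrict)
  moreover have "countable {A :: 'v set. finite A}"
    using countable_Collect_finite_subset[OF verts(1)] by simp
  ultimately have 5: "AE \<omega> in M z. \<forall>A\<in>{A. finite A}. \<forall>y\<in>-A. \<forall>q\<in>\<rat> \<inter> {0..}. \<forall>x.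
      (\<exists>C\<in>components_off E A. x \<in> C \<and> y \<notin> C) \<longrightarrow>
      X z q \<omega> = Some x \<longrightarrow> hits_avoiding A (insert y A) (\<lambda>s. X z (s + q) \<omega>)"
    using countable_subset[OF subset_UNIV verts(1)]
    by (subst AE_ball_countable, simp) (intro ballI, subst AE_ball_countable, auto)
  have "AE \<omega> in M z. \<forall>x\<in>UNIV. \<forall>T\<in>UNIV. finite (exits_before (real T) x (\<lambda>s. X z s \<omega>))"
    using AE_finite_exits by (simp only: AE_ball_countable[OF verts(1)] AE_ball_countable[OF countableI_type]) simp
  with 1 2 3 4 5 show ?thesis
  proof eventually_elim
    case (elim \<omega>)
    show ?case
    proof
      show "X z q \<omega> \<noteq> None" if "q \<in> \<rat>" "0 \<le> q" for q
        using elim(1) that by simp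
      show "\<exists>\<epsilon>>0. \<forall>s\<in>{t..t+\<epsilon>}. X z s \<omega> = X z t \<omega>" if "0 \<le> t" "X z t \<omega> \<noteq> None" for t
        using elim(2) that by blast
      show "exits_to_vertex x (\<lambda>s. X z (s + q) \<omega>)" if "q \<in> \<rat>" "0 \<le> q" "X z q \<omega> = Some x" for q x
        using elim(3) that by simp
      \<comment> \<open>Fact \<open>4\<close> presupposes a vertex at time \<open>q\<close>; fact
        \<open>1\<close> provides it.\<close>
      show "hits_avoiding {x} {x} (\<lambda>s. X z (s + q) \<omega>)" if "q \<in> \<rat>" "0 \<le> q" for q x
        using elim(1,4) that by fastforce
      show "hits_avoiding A (insert y A) (\<lambda>s. X z (s + q) \<omega>)"
        if "q \<in> \<rat>" "0 \<le> q" "finite A" "C \<in> components_off E A" "x \<in> C" "y \<notin> C" "y \<notin> A"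
          "X z q \<omega> = Some x" for q A C x y
      proof -
        have "A \<in> {A. finite A}" "y \<in> - A" "q \<in> \<rat> \<inter> {0..}" using that by auto
        then show ?thesis using elim(5) that(4-6,8) by blast
      qed
      show "finite (exits_before (real T) x (\<lambda>s. X z s \<omega>))" for T x
        using elim(6) by simp
    qed
  qed
qed

end

theorem proposition5p3:
  fixes E :: "'v set set" and c :: "'v set \<Rightarrow> real"
    and w\<^sub>0 w :: "'v \<Rightarrow> real"
    and M :: "'v \<Rightarrow> 'w measure" and X :: "'v \<Rightarrow> real \<Rightarrow> 'w \<Rightarrow> 'v option"
    and z :: 'v
  assumes "countable (UNIV :: 'v set)" and "infinite (UNIV :: 'v set)"
    and "conductance_graph E c" and "connected_graph E" and "locally_finite_graph E"
    and "reflection_threshold E c w\<^sub>0" and "\<forall>x. w\<^sub>0 x \<le> w x"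
    and "reflected_walk E c w M X"
  shows "AE \<omega> in M z. \<forall>t\<ge>0. X z t \<omega> = None \<longrightarrow>
    (\<exists>!\<xi>. \<xi> \<in> ends E \<and>
      (\<forall>W. finite_exhaustion W \<longrightarrow>
        (\<forall>n\<ge>1. \<exists>\<epsilon>>0. \<forall>s\<ge>0. t - \<epsilon> < s \<and> s < t + \<epsilon> \<longrightarrow>
           X z s \<omega> \<in> Some ` end_component E (W n) \<xi> \<union> {None})))"
proof -
  have "0 < w x" for x
    using assms(6,7) unfolding reflection_threshold_def by (meson less_le_trans)
  then interpret walk_on_graph E c w M X
    using assms by unfold_locales
  show ?thesis
    using AE_good_trajectory
  proof eventually_elim
    case (elim \<omega>)
    then interpret good_trajectory E "\<lambda>s. X z s \<omega>" .
    show ?case using unique_end_at_infinity[OF assms(1,4,5)] by blast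
  qed
qed

end
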